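(* Let $n\ge2$, and assume $\phi:S^{n-1}\to\mathbb R^n$ satisfies a Lipschitz condition $$|\phi(\xi)-\phi(\eta)|\le L|\xi-\eta|,\qquad \xi,\eta\in S^{n-1},$$ and that $u=P[\phi]:B^n\to\mathbb R^n$ is $K$-quasiregular. Then $$|u(x)-u(y)|\le C'|x-y|,\qquad x,y\in B^n,$$ where $C'$ depends on $L$, $K$ and $n$ only.
   Context: $B^n$ is the open unit ball and $S^{n-1}$ the unit sphere of $\mathbb R^n$. $P[\phi](x)=\int_{S^{n-1}}P(x,\xi)\phi(\xi)\,d\sigma(\xi)$, $x\in B^n$, where $P(x,\xi)=\frac{1-|x|^2}{|x-\xi|^n}$ is the Poisson kernel and $\sigma$ is normalized surface measure on $S^{n-1}$. $K$-quasiregular is used in the standard sense of the theory of quasiregular mappings in $\mathbb R^n$. *)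

theory Defs
  imports "HOL-Analysis.Analysis"
begin

text \<open>
  Normalized surface measure on the unit sphere, as a Borel measure on the whole space that is
  concentrated on the sphere. It comes from integration in polar coordinates: the surface measure
  of \<open>A\<close> is the dimension times the Lebesgue measure of the cone
  \<open>{r \<xi> | 0 < r < 1, \<xi> \<in> A}\<close>, and after normalization it is the volume of that cone
  divided by the volume of the unit ball. The cone is the preimage of \<open>A\<close> in the unit ball under
  \<open>sgn x = x / norm x\<close>; the origin, where \<open>sgn 0 = 0\<close>, is a null set.
\<close>

definition sphere_measure :: "('a :: euclidean_space) measure" where
  "sphere_measure = distr (uniform_measure lborel (ball 0 1)) borel sgn"

lemma borel_measurable_sgn_euclidean: "(sgn :: 'a :: euclidean_space \<Rightarrow> 'a) \<in> borel_measurable borel"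
  unfolding sgn_div_norm by measurable

lemma emeasure_sphere_measure:
  fixes A :: "'a :: euclidean_space set"
  assumes "A \<in> sets borel" "A \<subseteq> sphere 0 1"
  shows "emeasure sphere_measure A =
    emeasure lborel {r *\<^sub>R \<xi> | r \<xi>. 0 < r \<and> r < 1 \<and> \<xi> \<in> A} / emeasure lborel (ball (0::'a) 1)"
proof -
  have cone: "ball 0 1 \<inter> sgn -` A = {r *\<^sub>R \<xi> | r \<xi>. 0 < r \<and> r < 1 \<and> \<xi> \<in> A}"
  proof (intro equalityI subsetI)
    fix x assume x: "x \<in> ball 0 1 \<inter> sgn -` A"
    then have "norm (sgn x) = 1" using assms(2) by auto
    then have "x \<noteq> 0" by auto
    then have "x = norm x *\<^sub>R sgn x" "0 < norm x" by (auto simp: sgn_div_norm)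
    with x show "x \<in> {r *\<^sub>R \<xi> | r \<xi>. 0 < r \<and> r < 1 \<and> \<xi> \<in> A}"
      by (intro CollectI exI[of _ "norm x"] exI[of _ "sgn x"]) simp
  next
    fix x assume "x \<in> {r *\<^sub>R \<xi> | r \<xi>. 0 < r \<and> r < 1 \<and> \<xi> \<in> A}"
    then obtain r \<xi> where r: "x = r *\<^sub>R \<xi>" "0 < r" "r < 1" "\<xi> \<in> A" by blast
    then have "norm \<xi> = 1" using assms(2) by auto
    with r show "x \<in> ball 0 1 \<inter> sgn -` A" by (auto simp: sgn_div_norm)
  qed
  have m: "sgn -` A \<in> sets borel"
    using measurable_sets[OF borel_measurable_sgn_euclidean assms(1)] by simp
  have "emeasure sphere_measure A = emeasure (uniform_measure lborel (ball 0 1)) (sgn -` A)"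
    unfolding sphere_measure_def using assms(1) borel_measurable_sgn_euclidean
    by (subst emeasure_distr) auto
  also have "\<dots> = emeasure lborel (ball 0 1 \<inter> sgn -` A) / emeasure lborel (ball (0::'a) 1)"
    using m by (subst emeasure_uniform_measure) auto
  finally show ?thesis unfolding cone .
qed

definition poisson_kernel :: "real^'n \<Rightarrow> real^'n \<Rightarrow> real" where
  "poisson_kernel x \<xi> = (1 - (norm x)\<^sup>2) / norm (x - \<xi>) ^ CARD('n)"

definition poisson_integral :: "(real^'n \<Rightarrow> real^'n) \<Rightarrow> real^'n \<Rightarrow> real^'n" where
  "poisson_integral \<phi> x = (LINT \<xi>:sphere 0 1|sphere_measure. poisson_kernel x \<xi> *\<^sub>R \<phi> \<xi>)"

text \<open>
  Absolute continuity on a compact interval. The finite families of nonoverlapping closed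
  subintervals are the divisions \<open>d\<close> of their own union; a member \<open>k\<close> has endpoints
  \<open>Inf k\<close> and \<open>Sup k\<close>.
\<close>

definition abs_continuous_on_interval ::
    "real \<Rightarrow> real \<Rightarrow> (real \<Rightarrow> 'a :: real_normed_vector) \<Rightarrow> bool" where
  "abs_continuous_on_interval a b g \<longleftrightarrow>
    (\<forall>\<epsilon>>0. \<exists>\<delta>>0. \<forall>d. d division_of \<Union>d \<longrightarrow> \<Union>d \<subseteq> {a..b} \<longrightarrow>
      (\<Sum>k\<in>d. Sup k - Inf k) < \<delta> \<longrightarrow> (\<Sum>k\<in>d. norm (g (Sup k) - g (Inf k))) < \<epsilon>)"

text \<open>
  ACL: on every closed interval \<open>cbox a b\<close> in \<open>G\<close> and for every \<open>i\<close>, the map is absolutely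
  continuous on almost every segment of the interval parallel to the \<open>i\<close>-th axis. The segments are
  parametrized by the coordinates \<open>z j\<close>, \<open>j \<noteq> i\<close>, and "almost every" refers to the
  Lebesgue measure of dimension \<open>CARD('n) - 1\<close> in these coordinates.
\<close>

definition ACL :: "(real^'n) set \<Rightarrow> (real^'n \<Rightarrow> real^'m) \<Rightarrow> bool" where
  "ACL G f \<longleftrightarrow> continuous_on G f \<and>
    (\<forall>a b. cbox a b \<subseteq> G \<longrightarrow>
      (\<forall>i. AE z in (\<Pi>\<^sub>M j\<in>UNIV - {i}. lborel).
        (\<forall>j. j \<noteq> i \<longrightarrow> a $ j \<le> z j \<and> z j \<le> b $ j) \<longrightarrow>
        abs_continuous_on_interval (a $ i) (b $ i) (\<lambda>t. f (\<chi> j. if j = i then t else z j))))"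

definition partial_deriv :: "(real^'n \<Rightarrow> real^'m) \<Rightarrow> 'n \<Rightarrow> real^'n \<Rightarrow> real^'m" where
  "partial_deriv f i x = vector_derivative (\<lambda>t. f (x + t *\<^sub>R axis i 1)) (at 0)"

text \<open>
  ACL maps whose partial derivatives, which exist almost everywhere in \<open>G\<close>, are locally
  \<open>p\<close>-integrable. On the exceptional null set \<^const>\<open>vector_derivative\<close> has an
  arbitrary value, so integrability refers to the completed Lebesgue measure.
\<close>

definition ACL_p :: "nat \<Rightarrow> (real^'n) set \<Rightarrow> (real^'n \<Rightarrow> real^'m) \<Rightarrow> bool" where
  "ACL_p p G f \<longleftrightarrow> ACL G f \<and>
    (\<forall>i F. compact F \<longrightarrow> F \<subseteq> G \<longrightarrow> set_integrable lebesgue F (\<lambda>x. norm (partial_deriv f i x) ^ p))"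

text \<open>The matrix of the formal derivative, with columns the partial derivatives.\<close>

definition formal_deriv :: "(real^'n \<Rightarrow> real^'m) \<Rightarrow> real^'n \<Rightarrow> real^'n^'m" where
  "formal_deriv f x = (\<chi> k i. partial_deriv f i x $ k)"

text \<open>
  The analytic definition, with \<open>K\<close> bounding the outer dilatation: \<open>|f'|\<^sup>n \<le> K J\<^sub>f\<close>
  almost everywhere. Authors who require in addition \<open>J\<^sub>f \<le> K l(f')\<^sup>n\<close> (inner
  dilatation) have a smaller class of \<open>K\<close>-quasiregular maps.
\<close>

definition quasiregular :: "real \<Rightarrow> (real^'n) set \<Rightarrow> (real^'n \<Rightarrow> real^'n) \<Rightarrow> bool" where
  "quasiregular K G f \<longleftrightarrow> open G \<and> connected G \<and> K \<ge> 1 \<and> ACL_p CARD('n) G f \<and>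
    (AE x in lebesgue. x \<in> G \<longrightarrow>
      onorm ((*v) (formal_deriv f x)) ^ CARD('n) \<le> K * det (formal_deriv f x))"

end

theory Submission
  imports Defs
begin

text \<open>
  Write \<open>u = P[\<phi>]\<close>. Since \<open>\<sigma>\<close> is rotation invariant,
  \<open>u(Ax) - u(x) = P[\<phi> \<circ> A - \<phi>](x)\<close> for orthogonal \<open>A\<close>, so the Lipschitz condition gives
  \<open>|u(Ax) - u(x)| \<le> C L \<parallel>A - I\<parallel> |x|\<close>. Letting \<open>A\<close> run through small rotations of a plane
  containing \<open>x\<close> bounds the derivative of \<open>u\<close> in the directions orthogonal to \<open>x\<close> by
  \<open>T L\<close>, where \<open>T\<close> depends on \<open>n\<close> only. Hence
  \<open>|det u'(x)| \<le> n! |u'(x)| (T L)\<^sup>n\<^sup>-\<^sup>1\<close>, and quasiregularity,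
  \<open>|u'|\<^sup>n \<le> K det u'\<close>, leaves \<open>|u'| \<le> K n! T L\<close> almost everywhere. As \<open>u\<close> is
  continuously differentiable, the bound holds everywhere in the convex ball.
\<close>

section \<open>Rotation invariance of the surface measure\<close>

lemma borel_measurable_orthogonal_transformation:
  fixes f :: "'a::euclidean_space \<Rightarrow> 'a"
  assumes "orthogonal_transformation f"
  shows "f \<in> borel_measurable borel"
  using assms by (intro borel_measurable_continuous_onI linear_continuous_on)
    (simp add: orthogonal_transformation_linear linear_linear)

lemma nn_integral_lborel_translate:
  fixes h :: "'a::euclidean_space \<Rightarrow> ennreal"
  assumes [measurable]: "h \<in> borel_measurable borel"
  shows "(\<integral>\<^sup>+x. h (c + x) \<partial>lborel) = (\<integral>\<^sup>+x. h x \<partial>lborel)"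
proof -
  have "(\<integral>\<^sup>+x. h x \<partial>lborel) = (\<integral>\<^sup>+x. h x \<partial>(distr lborel borel ((+) c)))"
    by (simp add: lborel_distr_plus)
  also have "\<dots> = (\<integral>\<^sup>+x. h (c + x) \<partial>lborel)"
    by (subst nn_integral_distr) auto
  finally show ?thesis by simp
qed

lemma
  shows emeasure_unit_ball_neq_0: "emeasure lborel (ball (0::'a::euclidean_space) 1) \<noteq> 0"
    and emeasure_unit_ball_finite: "emeasure lborel (ball (0::'a::euclidean_space) 1) \<noteq> \<infinity>"
  using unit_ball_vol_pos[of "real DIM('a)"] by (simp_all add: emeasure_ball del: unit_ball_vol_pos)

text \<open>
  Rotation invariance by the uniqueness argument for Haar measure: with \<open>B\<close> the unit ball, which
  \<open>f\<close> preserves, the integral of \<open>1\<^sub>A(x) 1\<^sub>B(x - f z)\<close> over \<open>(x, z)\<close> equals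
  \<open>\<lambda>(A) \<lambda>(B)\<close>, and after translating \<open>x\<close> by \<open>f z\<close> it equals \<open>\<lambda>(f\<^sup>-\<^sup>1 A) \<lambda>(B)\<close>.
  The library has this fact only for \<open>real^'n\<close> with a well-ordered index type.
\<close>

lemma lborel_distr_orthogonal:
  fixes f :: "'a::euclidean_space \<Rightarrow> 'a"
  assumes f: "orthogonal_transformation f"
  shows "distr lborel borel f = lborel"
proof (rule measure_eqI)
  fix A assume "A \<in> sets (distr lborel borel f)"
  then have A[measurable]: "A \<in> sets borel" by simp
  note [measurable] = borel_measurable_orthogonal_transformation[OF f]
  define B :: "'a set" where "B = ball 0 1"
  have [measurable]: "B \<in> sets borel" by (simp add: B_def)
  have lin: "linear f" using f by (rule orthogonal_transformation_linear)
  have surj: "\<exists>c. f c = x" for x using orthogonal_transformation_surj[OF f] by (metis surjD)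
  \<comment> \<open>As \<open>f\<close> is linear and onto, adding \<open>x\<close> to
    \<open>f z\<close> amounts to translating \<open>z\<close>, so translation invariance of
    \<open>lborel\<close> is enough here.\<close>
  have shift: "(\<integral>\<^sup>+z. h (x + f z) \<partial>lborel) = (\<integral>\<^sup>+z. h (f z) \<partial>lborel)"
    if [measurable]: "h \<in> borel_measurable borel" for h :: "'a \<Rightarrow> ennreal" and x
  proof -
    obtain c where c: "f c = x" using surj by blast
    have "(\<integral>\<^sup>+z. h (x + f z) \<partial>lborel) = (\<integral>\<^sup>+z. h (f (c + z)) \<partial>lborel)"
      using c lin by (simp add: linear_add)
    also have "\<dots> = (\<integral>\<^sup>+z. h (f z) \<partial>lborel)"
      by (rule nn_integral_lborel_translate[of "\<lambda>z. h (f z)"]) simp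
    finally show ?thesis .
  qed
  let ?I = "\<integral>\<^sup>+x. (\<integral>\<^sup>+z. indicator A x * indicator B (x - f z) \<partial>lborel) \<partial>lborel :: ennreal"
  have "(\<integral>\<^sup>+z. indicator B (x - f z) \<partial>lborel) = emeasure lborel B" for x
  proof -
    have "(\<integral>\<^sup>+z. indicator B (x - f z) \<partial>lborel) = (\<integral>\<^sup>+z. indicator B (-x + f z) \<partial>(lborel::'a measure) :: ennreal)"
      by (intro nn_integral_cong) (auto simp: B_def indicator_def norm_minus_commute)
    also have "\<dots> = (\<integral>\<^sup>+z. indicator B (f z) \<partial>lborel)"
      by (rule shift[of "indicator B"]) simp
    also have "\<dots> = (\<integral>\<^sup>+z. indicator B z \<partial>lborel)"
      using f by (intro nn_integral_cong)
        (auto simp: B_def indicator_def orthogonal_transformation_norm)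
    finally show ?thesis by simp
  qed
  then have 1: "?I = emeasure lborel A * emeasure lborel B"
    by (simp add: nn_integral_cmult nn_integral_multc)
  have "?I = (\<integral>\<^sup>+z. (\<integral>\<^sup>+x. indicator A x * indicator B (x - f z) \<partial>lborel) \<partial>lborel)"
    by (rule lborel_pair.Fubini') simp
  also have "\<dots> = (\<integral>\<^sup>+z. (\<integral>\<^sup>+x. indicator A (f z + x) * indicator B x \<partial>lborel) \<partial>lborel)"
  proof (rule nn_integral_cong)
    fix z
    show "(\<integral>\<^sup>+x. indicator A x * indicator B (x - f z) \<partial>lborel)
        = (\<integral>\<^sup>+x. indicator A (f z + x) * indicator B x \<partial>lborel :: ennreal)"
      using nn_integral_lborel_translate[of "\<lambda>x. indicator A x * indicator B (x - f z)" "f z"]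
      by simp
  qed
  also have "\<dots> = (\<integral>\<^sup>+x. (\<integral>\<^sup>+z. indicator A (f z + x) * indicator B x \<partial>lborel) \<partial>lborel)"
    by (rule lborel_pair.Fubini') simp
  also have "\<dots> = (\<integral>\<^sup>+x. (\<integral>\<^sup>+z. indicator A (f z) \<partial>lborel) * indicator B x \<partial>lborel)"
  proof (rule nn_integral_cong)
    fix x
    have "(\<integral>\<^sup>+z. indicator A (f z + x) * indicator B x \<partial>lborel)
       = (\<integral>\<^sup>+z. indicator A (x + f z) \<partial>lborel) * (indicator B x :: ennreal)"
      by (subst nn_integral_multc) (auto simp: add.commute)
    also have "(\<integral>\<^sup>+z. indicator A (x + f z) \<partial>lborel) = (\<integral>\<^sup>+z. indicator A (f z) \<partial>lborel :: ennreal)"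
      by (rule shift[of "indicator A"]) simp
    finally show "(\<integral>\<^sup>+z. indicator A (f z + x) * indicator B x \<partial>lborel)
       = (\<integral>\<^sup>+z. indicator A (f z) \<partial>lborel) * (indicator B x :: ennreal)" .
  qed
  also have "\<dots> = (\<integral>\<^sup>+z. indicator A (f z) \<partial>lborel) * emeasure lborel B"
    by (simp add: nn_integral_cmult)
  also have "(\<integral>\<^sup>+z. indicator A (f z) \<partial>lborel) = (\<integral>\<^sup>+z. indicator A z \<partial>(distr lborel borel f))"
    by (subst nn_integral_distr) auto
  also have "\<dots> = emeasure (distr lborel borel f) A" by simp
  finally have "emeasure (distr lborel borel f) A * emeasure lborel B
      = emeasure lborel A * emeasure lborel B" using 1 by simp
  \<comment> \<open>The common factor can be cancelled because the ball has positive finite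
    volume.\<close>
  moreover have "emeasure lborel B \<noteq> 0" "emeasure lborel B \<noteq> \<infinity>"
    using emeasure_unit_ball_neq_0[where 'a='a] emeasure_unit_ball_finite[where 'a='a]
    by (simp_all add: B_def)
  ultimately show "emeasure (distr lborel borel f) A = emeasure lborel A"
    by (simp add: ennreal_mult_cancel_left mult.commute[of _ "emeasure lborel B"])
qed simp

section \<open>The surface measure as a rotation invariant probability measure\<close>

lemma
  shows sets_sphere_measure [simp, measurable_cong]: "sets sphere_measure = sets borel"
    and space_sphere_measure [simp]: "space sphere_measure = UNIV"
  by (simp_all add: sphere_measure_def)

lemma emeasure_sphere_measure_UNIV:
  "emeasure (sphere_measure :: 'a::euclidean_space measure) UNIV = 1"
proof -
  have "emeasure (sphere_measure :: 'a measure) UNIV =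
      emeasure (uniform_measure lborel (ball (0::'a) 1)) UNIV"
    unfolding sphere_measure_def using borel_measurable_sgn_euclidean
    by (subst emeasure_distr) auto
  also have "\<dots> = 1"
    using emeasure_unit_ball_neq_0[where 'a='a] emeasure_unit_ball_finite[where 'a='a]
    by (subst emeasure_uniform_measure) (auto intro!: ennreal_divide_self simp: less_top)
  finally show ?thesis .
qed

lemma finite_measure_sphere_measure: "finite_measure (sphere_measure :: 'a::euclidean_space measure)"
  by (rule finite_measureI) (simp add: emeasure_sphere_measure_UNIV)

lemma measure_sphere_measure_le_1:
  fixes A :: "'a::euclidean_space set"
  shows "measure sphere_measure A \<le> 1"
proof -
  have "measure sphere_measure A \<le> measure sphere_measure (space (sphere_measure :: 'a measure))"
    by (rule finite_measure.bounded_measure[OF finite_measure_sphere_measure])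
  also have "\<dots> = 1" by (simp add: measure_def emeasure_sphere_measure_UNIV)
  finally show ?thesis .
qed

text \<open>An orthogonal map commutes with \<open>sgn\<close> and preserves the unit ball, so the
  cone over the preimage of a set is the preimage of the cone. Invariance of Lebesgue measure then
  carries over.\<close>

lemma sphere_measure_distr_orthogonal:
  fixes f :: "'a::euclidean_space \<Rightarrow> 'a"
  assumes f: "orthogonal_transformation f"
  shows "distr sphere_measure borel f = sphere_measure"
proof (rule measure_eqI)
  fix A assume "A \<in> sets (distr sphere_measure borel f)"
  then have A[measurable]: "A \<in> sets borel" by simp
  note [measurable] = borel_measurable_orthogonal_transformation[OF f]
    borel_measurable_sgn_euclidean
  have sgn: "sgn (f y) = f (sgn y)" for y
    using f by (simp add: sgn_div_norm orthogonal_transformation_norm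
        orthogonal_transformation_linear linear_cmul)
  \<comment> \<open>Unlike \<open>emeasure_sphere_measure\<close>, this covers Borel sets that are
    not contained in the sphere, as \<open>measure_eqI\<close> requires.\<close>
  have e: "emeasure sphere_measure C =
      emeasure lborel (ball 0 1 \<inter> sgn -` C) / emeasure lborel (ball (0::'a) 1)"
    if [measurable]: "C \<in> sets borel" for C :: "'a set"
  proof -
    have m: "sgn -` C \<in> sets borel"
      using measurable_sets[OF borel_measurable_sgn_euclidean that] by simp
    show ?thesis unfolding sphere_measure_def using m
      by (subst emeasure_distr) (auto simp: emeasure_uniform_measure)
  qed
  have m: "sgn -` A \<in> sets borel" "f -` A \<in> sets borel"
    using measurable_sets[OF borel_measurable_sgn_euclidean A]
      measurable_sets[OF borel_measurable_orthogonal_transformation[OF f] A] by simp_all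
  have "emeasure (distr sphere_measure borel f) A = emeasure sphere_measure (f -` A)"
    by (subst emeasure_distr) auto
  also have "\<dots> = emeasure lborel (ball 0 1 \<inter> sgn -` (f -` A)) / emeasure lborel (ball (0::'a) 1)"
    using m by (intro e)
  also have "ball 0 1 \<inter> sgn -` (f -` A) = f -` (ball 0 1 \<inter> sgn -` A)"
    using f by (auto simp: sgn[symmetric] orthogonal_transformation_norm)
  also have "emeasure lborel (f -` (ball 0 1 \<inter> sgn -` A)) 
     = emeasure (distr lborel borel f) (ball 0 1 \<inter> sgn -` A)"
    using m by (subst emeasure_distr) auto
  also have "\<dots> = emeasure lborel (ball 0 1 \<inter> sgn -` A)"
    by (simp add: lborel_distr_orthogonal[OF f])
  finally show "emeasure (distr sphere_measure borel f) A = emeasure sphere_measure A"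
    by (simp add: e)
qed simp

lemma set_integral_sphere_orthogonal:
  fixes f :: "'a::euclidean_space \<Rightarrow> 'a" and g :: "'a \<Rightarrow> 'b::{banach, second_countable_topology}"
  assumes f: "orthogonal_transformation f" and g: "continuous_on (sphere 0 1) g"
  shows "(LINT \<xi>:sphere 0 1|sphere_measure. g (f \<xi>)) = (LINT \<xi>:sphere 0 1|sphere_measure. g \<xi>)"
proof -
  \<comment> \<open>Continuity of \<open>g\<close> is known on the sphere only; cutting off by the
    indicator gives a Borel function on the whole space, to which the change of variables
    applies.\<close>
  have m: "(\<lambda>\<xi>. indicator (sphere 0 1) \<xi> *\<^sub>R g \<xi>) \<in> borel_measurable borel"
    using g by (intro borel_measurable_continuous_on_indicator) auto
  have "(LINT \<xi>:sphere 0 1|sphere_measure. g \<xi>) =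
     (\<integral>\<xi>. indicator (sphere 0 1) \<xi> *\<^sub>R g \<xi> \<partial>(distr sphere_measure borel f))"
    by (simp add: sphere_measure_distr_orthogonal[OF f] set_lebesgue_integral_def)
  also have "\<dots> = (\<integral>\<xi>. indicator (sphere 0 1) (f \<xi>) *\<^sub>R g (f \<xi>) \<partial>sphere_measure)"
    using m borel_measurable_orthogonal_transformation[OF f]
    by (subst integral_distr) (auto simp: measurable_cong_sets[OF sets_sphere_measure refl])
  also have "\<dots> = (LINT \<xi>:sphere 0 1|sphere_measure. g (f \<xi>))"
    using f by (auto simp: set_lebesgue_integral_def indicator_def orthogonal_transformation_norm
        intro!: Bochner_Integration.integral_cong)
  finally show ?thesis by simp
qed

section \<open>Integrals of continuous functions over the sphere\<close>

lemma compact_continuous_norm_bound: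
  fixes g :: "'a::topological_space \<Rightarrow> 'b::real_normed_vector"
  assumes "compact S" "continuous_on S g"
  obtains B where "0 < B" "\<And>x. x \<in> S \<Longrightarrow> norm (g x) \<le> B"
proof -
  have "bounded (g ` S)" using assms by (intro compact_imp_bounded compact_continuous_image)
  then obtain B where B: "0 < B" "\<forall>y\<in>g ` S. norm y \<le> B" unfolding bounded_pos by blast
  show thesis by (rule that[OF B(1)]) (use B(2) in blast)
qed

lemma set_integrable_sphere_measure:
  fixes g :: "'a::euclidean_space \<Rightarrow> 'b::{banach, second_countable_topology}"
  assumes g: "continuous_on (sphere 0 1) g"
  shows "set_integrable sphere_measure (sphere 0 1) g"
proof -
  obtain B where B: "\<And>x. x \<in> sphere 0 1 \<Longrightarrow> norm (g x) \<le> B"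
    using compact_continuous_norm_bound[OF compact_sphere g] by blast
  have m: "(\<lambda>\<xi>. indicator (sphere 0 1) \<xi> *\<^sub>R g \<xi>) \<in> borel_measurable borel"
    using g by (intro borel_measurable_continuous_on_indicator) auto
  show ?thesis unfolding set_integrable_def
    by (rule integrableI_bounded_set[where A = "sphere 0 1" and B = B])
      (use m B in \<open>auto simp: measurable_cong_sets[OF sets_sphere_measure refl] 
         finite_measure.emeasure_finite[OF finite_measure_sphere_measure] less_top[symmetric]\<close>)
qed

lemma norm_set_integral_sphere_le:
  fixes g :: "'a::euclidean_space \<Rightarrow> 'b::{banach, second_countable_topology}"
  assumes g: "continuous_on (sphere 0 1) g" and B: "\<And>x. x \<in> sphere 0 1 \<Longrightarrow> norm (g x) \<le> B" "0 \<le> B"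
  shows "norm (LINT \<xi>:sphere 0 1|sphere_measure. g \<xi>) \<le> B"
proof -
  have "norm (LINT \<xi>:sphere 0 1|sphere_measure. g \<xi>) \<le> (LINT \<xi>:sphere 0 1|sphere_measure. norm (g \<xi>))"
    using g by (intro set_integral_norm_bound set_integrable_sphere_measure)
  also have "\<dots> \<le> (LINT \<xi>:sphere (0::'a) 1|sphere_measure. B)"
    using g B by (intro set_integral_mono set_integrable_sphere_measure continuous_intros) auto
  also have "\<dots> = B * measure sphere_measure (sphere (0::'a) 1)"
    by (simp add: set_lebesgue_integral_def)
  also have "\<dots> \<le> B * 1"
    using B by (intro mult_left_mono measure_sphere_measure_le_1)
  finally show ?thesis by simp
qed

section \<open>Differentiating the Poisson integral\<close>

lemma continuous_on_slice:
  assumes "continuous_on (U \<times> S) (\<lambda>(x, \<xi>). H x \<xi>)" "x \<in> U"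
  shows "continuous_on S (H x)"
proof -
  have "continuous_on S (\<lambda>\<xi>. (x, \<xi>))" by (rule continuous_on_Pair[OF continuous_on_const continuous_on_id])
  from continuous_on_compose2[OF assms(1) this] assms(2) show ?thesis by auto
qed

text \<open>Compactness of the sphere makes \<open>H x \<xi>\<close> close to
  \<open>H x0 \<xi>\<close> for all \<open>\<xi>\<close> at once when \<open>x\<close> is near
  \<open>x0\<close>; the integrals are then equally close because the total mass is
  \<open>1\<close>.\<close>

lemma continuous_on_sphere_integral:
  fixes H :: "'a::metric_space \<Rightarrow> 'c::euclidean_space \<Rightarrow> 'b::{banach, second_countable_topology}"
  assumes H: "continuous_on (U \<times> sphere 0 1) (\<lambda>(x, \<xi>). H x \<xi>)"
  shows "continuous_on U (\<lambda>x. LINT \<xi>:sphere 0 1|sphere_measure. H x \<xi>)"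
  unfolding continuous_on_iff
proof (intro ballI allI impI)
  fix x0 and e :: real assume x0: "x0 \<in> U" and e: "0 < e"
  have cont: "continuous_on (sphere 0 1) (H x)" if "x \<in> U" for x
    by (rule continuous_on_slice[OF H that])
  obtain X where X: "x0 \<in> X" "open X"
    "\<forall>x\<in>X \<inter> U. \<forall>\<xi>\<in>sphere 0 1. dist (case (x, \<xi>) of (x, \<xi>) \<Rightarrow> H x \<xi>) (case (x0, \<xi>) of (x, \<xi>) \<Rightarrow> H x \<xi>) \<le> e / 2"
    by (rule continuous_on_prod_compactE[OF H compact_sphere x0, of "e/2"]) (use e in auto)
  obtain d where d: "0 < d" "ball x0 d \<subseteq> X" using X by (meson openE)
  show "\<exists>d>0. \<forall>x\<in>U. dist x x0 < d \<longrightarrow> dist (LINT \<xi>:sphere 0 1|sphere_measure. H x \<xi>)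
      (LINT \<xi>:sphere 0 1|sphere_measure. H x0 \<xi>) < e"
  proof (intro exI[of _ d] conjI ballI impI d(1))
    fix x assume x: "x \<in> U" "dist x x0 < d"
    have "dist (LINT \<xi>:sphere 0 1|sphere_measure. H x \<xi>) (LINT \<xi>:sphere 0 1|sphere_measure. H x0 \<xi>)
        = norm (LINT \<xi>:sphere 0 1|sphere_measure. H x \<xi> - H x0 \<xi>)"
      using x x0 cont by (simp add: dist_norm set_integral_diff set_integrable_sphere_measure)
    also have "\<dots> \<le> e / 2"
    proof (rule norm_set_integral_sphere_le)
      show "continuous_on (sphere 0 1) (\<lambda>\<xi>. H x \<xi> - H x0 \<xi>)"
        using x x0 cont by (intro continuous_intros)
      show "norm (H x \<xi> - H x0 \<xi>) \<le> e / 2" if "\<xi> \<in> sphere 0 1" for \<xi>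
        using X(3) that x d(2) by (auto simp: dist_norm dist_commute subset_iff)
    qed (use e in auto)
    also have "\<dots> < e" using e by simp
    finally show "dist (LINT \<xi>:sphere 0 1|sphere_measure. H x \<xi>)
      (LINT \<xi>:sphere 0 1|sphere_measure. H x0 \<xi>) < e" .
  qed
qed

lemma onorm_inner_le:
  fixes a :: "'a::real_inner"
  assumes "norm a \<le> B"
  shows "onorm (\<lambda>h. a \<bullet> h) \<le> B"
proof (rule onorm_bound)
  show "0 \<le> B" using norm_ge_zero assms by (rule order_trans)
  fix h
  have "norm (a \<bullet> h) \<le> norm a * norm h" by (simp add: Cauchy_Schwarz_ineq2)
  also have "\<dots> \<le> B * norm h" using assms by (intro mult_right_mono) auto
  finally show "norm (a \<bullet> h) \<le> B * norm h" .
qed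

text \<open>Differentiation under the integral sign. Joint continuity of the gradient
  \<open>G\<close> and compactness of the sphere make the linearization error of \<open>f\<close>
  small uniformly in \<open>\<xi>\<close>.\<close>

lemma has_derivative_sphere_integral:
  fixes f :: "'a::euclidean_space \<Rightarrow> 'c::euclidean_space \<Rightarrow> real" and G :: "'a \<Rightarrow> 'c \<Rightarrow> 'a"
    and \<phi> :: "'c \<Rightarrow> 'b::euclidean_space"
  assumes U: "open U" "x0 \<in> U"
    and der: "\<And>x \<xi>. x \<in> U \<Longrightarrow> \<xi> \<in> sphere 0 1 \<Longrightarrow> ((\<lambda>x. f x \<xi>) has_derivative (\<lambda>h. G x \<xi> \<bullet> h)) (at x)"
    and G: "continuous_on (U \<times> sphere 0 1) (\<lambda>(x, \<xi>). G x \<xi>)"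
    and f: "\<And>x. x \<in> U \<Longrightarrow> continuous_on (sphere 0 1) (f x)"
    and \<phi>: "continuous_on (sphere 0 1) \<phi>"
  shows "((\<lambda>x. LINT \<xi>:sphere 0 1|sphere_measure. f x \<xi> *\<^sub>R \<phi> \<xi>) has_derivative
    (\<lambda>h. LINT \<xi>:sphere 0 1|sphere_measure. (G x0 \<xi> \<bullet> h) *\<^sub>R \<phi> \<xi>)) (at x0)"
  unfolding has_derivative_at_alt
proof (intro conjI allI impI)
  let ?S = "sphere (0::'c) 1"
  let ?D = "\<lambda>h. LINT \<xi>:?S|sphere_measure. (G x0 \<xi> \<bullet> h) *\<^sub>R \<phi> \<xi>"
  have contG: "continuous_on ?S (G x)" if "x \<in> U" for x
    by (rule continuous_on_slice[OF G that])
  have intD: "set_integrable sphere_measure ?S (\<lambda>\<xi>. (G x0 \<xi> \<bullet> h) *\<^sub>R \<phi> \<xi>)" for h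
    using contG[OF U(2)] \<phi> by (intro set_integrable_sphere_measure continuous_intros)
  have "linear ?D"
  proof
    fix h k :: 'a and c :: real
    show "?D (h + k) = ?D h + ?D k"
      by (simp add: inner_add_right scaleR_left_distrib set_integral_add(2)[OF intD intD])
    show "?D (c *\<^sub>R h) = c *\<^sub>R ?D h"
      using set_integral_scaleR_right[of sphere_measure ?S c "\<lambda>\<xi>. (G x0 \<xi> \<bullet> h) *\<^sub>R \<phi> \<xi>"] by simp
  qed
  then show "bounded_linear ?D" by (simp add: linear_conv_bounded_linear)
  fix e :: real assume e: "0 < e"
  obtain M where M: "0 < M" "\<And>\<xi>. \<xi> \<in> ?S \<Longrightarrow> norm (\<phi> \<xi>) \<le> M"
    using compact_continuous_norm_bound[OF compact_sphere \<phi>] by blast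
  \<comment> \<open>The tolerance \<open>e / M\<close> compensates for the factor
    \<open>\<phi> \<xi>\<close>, whose norm is at most \<open>M\<close>.\<close>
  obtain X where X: "x0 \<in> X" "open X"
    "\<forall>x\<in>X \<inter> U. \<forall>\<xi>\<in>?S. dist (case (x, \<xi>) of (x, \<xi>) \<Rightarrow> G x \<xi>) (case (x0, \<xi>) of (x, \<xi>) \<Rightarrow> G x \<xi>) \<le> e / M"
    by (rule continuous_on_prod_compactE[OF G compact_sphere U(2), of "e/M"]) (use e M in auto)
  have "open (X \<inter> U)" "x0 \<in> X \<inter> U" using X U by auto
  then obtain d where d: "0 < d" "ball x0 d \<subseteq> X \<inter> U" by (meson openE)
  let ?u = "\<lambda>x. LINT \<xi>:?S|sphere_measure. f x \<xi> *\<^sub>R \<phi> \<xi>"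
  show "\<exists>d>0. \<forall>y. norm (y - x0) < d \<longrightarrow> norm (?u y - ?u x0 - ?D (y - x0)) \<le> e * norm (y - x0)"
  proof (intro exI[of _ d] conjI allI impI d(1))
    fix y assume "norm (y - x0) < d"
    then have y: "y \<in> ball x0 d" by (simp add: dist_norm norm_minus_commute)
    then have yU: "y \<in> U" using d by auto
    have int: "set_integrable sphere_measure ?S (\<lambda>\<xi>. f x \<xi> *\<^sub>R \<phi> \<xi>)" if "x \<in> U" for x
      using f[OF that] \<phi> by (intro set_integrable_sphere_measure continuous_intros)
    have "?u y - ?u x0 - ?D (y - x0) =
        (LINT \<xi>:?S|sphere_measure. f y \<xi> *\<^sub>R \<phi> \<xi> - f x0 \<xi> *\<^sub>R \<phi> \<xi> - (G x0 \<xi> \<bullet> (y - x0)) *\<^sub>R \<phi> \<xi>)"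
      using int U(2) yU intD by (simp add: set_integral_diff)
    also have "\<dots> = (LINT \<xi>:?S|sphere_measure. (f y \<xi> - f x0 \<xi> - G x0 \<xi> \<bullet> (y - x0)) *\<^sub>R \<phi> \<xi>)"
      by (simp add: scaleR_left_diff_distrib)
    also have "norm \<dots> \<le> (norm (y - x0) * (e / M)) * M"
    proof (rule norm_set_integral_sphere_le)
      show "continuous_on ?S (\<lambda>\<xi>. (f y \<xi> - f x0 \<xi> - G x0 \<xi> \<bullet> (y - x0)) *\<^sub>R \<phi> \<xi>)"
        using f[OF yU] f[OF U(2)] contG[OF U(2)] \<phi> by (intro continuous_intros)
      fix \<xi> assume \<xi>: "\<xi> \<in> ?S"
      \<comment> \<open>On the ball the gradient differs from its value at \<open>x0\<close> by at
        most \<open>e / M\<close>, so the mean value inequality applied to \<open>f\<close> minus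
        its linear part bounds the error.\<close>
      have "norm (f y \<xi> - f x0 \<xi> - (\<lambda>h. G x0 \<xi> \<bullet> h) (y - x0)) \<le> norm (y - x0) * (e / M)"
      proof (rule differentiable_bound_linearization[where S = "ball x0 d" and f' = "\<lambda>x h. G x \<xi> \<bullet> h"])
        fix t :: real assume "t \<in> {0..1}"
        then have "t * norm (y - x0) \<le> norm (y - x0)" by (simp add: mult_left_le_one_le)
        then show "x0 + t *\<^sub>R (y - x0) \<in> ball x0 d" using y \<open>t \<in> _\<close> by (simp add: dist_norm norm_minus_commute)
      next
        fix x assume x: "x \<in> ball x0 d"
        show "((\<lambda>x. f x \<xi>) has_derivative (\<lambda>h. G x \<xi> \<bullet> h)) (at x within ball x0 d)"
          by (rule has_derivative_at_withinI, rule der) (use x d \<xi> in auto)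
        have "norm (G x \<xi> - G x0 \<xi>) \<le> e / M"
          using bspec[OF bspec[OF X(3) subsetD[OF d(2) x]] \<xi>] by (simp add: dist_norm)
        moreover have "(\<lambda>h. G x \<xi> \<bullet> h) - (\<lambda>h. G x0 \<xi> \<bullet> h) = (\<lambda>h. (G x \<xi> - G x0 \<xi>) \<bullet> h)"
          by (simp add: fun_eq_iff inner_diff_left)
        ultimately show "onorm ((\<lambda>h. G x \<xi> \<bullet> h) - (\<lambda>h. G x0 \<xi> \<bullet> h)) \<le> e / M"
          by (simp only: onorm_inner_le)
      qed (use d in auto)
      then show "norm ((f y \<xi> - f x0 \<xi> - G x0 \<xi> \<bullet> (y - x0)) *\<^sub>R \<phi> \<xi>) \<le> (norm (y - x0) * (e / M)) * M"
        unfolding norm_scaleR real_norm_def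
        by (rule mult_mono[OF _ M(2)[OF \<xi>]]) (use e M(1) in auto)
    qed (use e M in auto)
    finally show "norm (?u y - ?u x0 - ?D (y - x0)) \<le> e * norm (y - x0)"
      using M by (simp add: mult.commute)
  qed
qed

section \<open>Gradient of the Poisson kernel\<close>

text \<open>This is the gradient in the first variable by the quotient rule: the first term
  differentiates \<open>1 - (norm x)\<^sup>2\<close>, and \<open>sgn (x - \<xi>)\<close> is the
  gradient of \<open>norm (x - \<xi>)\<close>.\<close>

definition poisson_grad :: "real^'n \<Rightarrow> real^'n \<Rightarrow> real^'n" where
  "poisson_grad x \<xi> = (- 2 / norm (x - \<xi>) ^ CARD('n)) *\<^sub>R x
     - (CARD('n) * (1 - (norm x)\<^sup>2) / norm (x - \<xi>) ^ (CARD('n) + 1)) *\<^sub>R sgn (x - \<xi>)"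

lemma has_derivative_poisson_kernel:
  fixes x \<xi> :: "real^'n"
  assumes "x \<noteq> \<xi>"
  shows "((\<lambda>x. poisson_kernel x \<xi>) has_derivative (\<lambda>h. poisson_grad x \<xi> \<bullet> h)) (at x)"
proof -
  have 1: "((\<lambda>x. norm (x - \<xi>)) has_derivative (\<lambda>h. h \<bullet> sgn (x - \<xi>))) (at x)"
    by (rule has_derivative_compose[where f = "\<lambda>x. x - \<xi>" and f' = "\<lambda>h. h" and g = norm
        and g' = "\<lambda>h. h \<bullet> sgn (x - \<xi>)"])
      (use assms in \<open>auto intro!: derivative_eq_intros has_derivative_norm\<close>)
  have 2: "((\<lambda>x. 1 - (norm x)\<^sup>2) has_derivative (\<lambda>h. - 2 * (x \<bullet> h))) (at x)"
    unfolding power2_norm_eq_inner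
    by (auto intro!: derivative_eq_intros simp: inner_commute)
  \<comment> \<open>Writing the dimension as a successor removes the truncated subtraction in the
    exponent that the power rule produces.\<close>
  obtain m where m: "CARD('n) = Suc m" using not0_implies_Suc[of "CARD('n)"] by auto
  define N where "N = norm (x - \<xi>)"
  have N: "N \<noteq> 0" using assms by (simp add: N_def)
  have "((\<lambda>x. poisson_kernel x \<xi>) has_derivative (\<lambda>h.
      ((- 2 * (x \<bullet> h)) * N ^ CARD('n)
        - (1 - (norm x)\<^sup>2) * (real CARD('n) * (h \<bullet> sgn (x - \<xi>)) * N ^ (CARD('n) - 1)))
      / (N ^ CARD('n) * N ^ CARD('n)))) (at x)"
    unfolding poisson_kernel_def N_def
    by (rule has_derivative_divide'[OF 2 has_derivative_power[OF 1]]) (use assms in simp)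
  moreover have "((- 2 * (x \<bullet> h)) * N ^ CARD('n)
        - (1 - (norm x)\<^sup>2) * (real CARD('n) * (h \<bullet> sgn (x - \<xi>)) * N ^ (CARD('n) - 1)))
      / (N ^ CARD('n) * N ^ CARD('n)) = poisson_grad x \<xi> \<bullet> h" for h
    unfolding poisson_grad_def inner_diff_left inner_scaleR_left N_def[symmetric]
      inner_commute[of h] using N by (simp add: m field_simps)
  ultimately show ?thesis by simp
qed

text \<open>No point of the open ball lies on the sphere, so the denominators do not vanish.\<close>

lemma
  shows continuous_on_poisson_grad:
      "continuous_on (ball 0 1 \<times> sphere (0::real^'n) 1) (\<lambda>(x, \<xi>). poisson_grad x \<xi>)"
    and continuous_on_poisson_kernel:
      "continuous_on (ball 0 1 \<times> sphere (0::real^'n) 1) (\<lambda>(x, \<xi>). poisson_kernel x \<xi>)"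
  by (auto simp: case_prod_beta poisson_grad_def poisson_kernel_def sgn_div_norm intro!: continuous_intros)

lemma has_derivative_poisson_integral:
  fixes \<phi> :: "real^'n \<Rightarrow> real^'n"
  assumes "continuous_on (sphere 0 1) \<phi>" "x \<in> ball 0 1"
  shows "(poisson_integral \<phi> has_derivative
    (\<lambda>h. LINT \<xi>:sphere 0 1|sphere_measure. (poisson_grad x \<xi> \<bullet> h) *\<^sub>R \<phi> \<xi>)) (at x)"
  unfolding poisson_integral_def[abs_def]
  using assms by (intro has_derivative_sphere_integral[where U = "ball 0 1"]
      has_derivative_poisson_kernel continuous_on_poisson_grad
      continuous_on_slice[OF continuous_on_poisson_kernel]) auto

text \<open>This continuity lets an almost everywhere bound on the derivative extend to every point
  of the ball.\<close>

lemma continuous_on_derivative_poisson_integral: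
  fixes \<phi> :: "real^'n \<Rightarrow> real^'n"
  assumes "continuous_on (sphere 0 1) \<phi>"
  shows "continuous_on (ball 0 1)
    (\<lambda>x. LINT \<xi>:sphere 0 1|sphere_measure. (poisson_grad x \<xi> \<bullet> h) *\<^sub>R \<phi> \<xi>)"
proof (rule continuous_on_sphere_integral)
  let ?K = "ball 0 1 \<times> sphere (0::real^'n) 1"
  have "continuous_on ?K (\<lambda>z. \<phi> (snd z))"
    by (rule continuous_on_compose2[OF assms continuous_on_snd[OF continuous_on_id]]) auto
  moreover have "continuous_on ?K (\<lambda>z. poisson_grad (fst z) (snd z))"
    using continuous_on_poisson_grad by (simp add: case_prod_beta)
  ultimately have "continuous_on ?K (\<lambda>z. (poisson_grad (fst z) (snd z) \<bullet> h) *\<^sub>R \<phi> (snd z))"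
    by (intro continuous_on_scaleR continuous_on_inner continuous_on_const)
  then show "continuous_on ?K (\<lambda>(x, \<xi>). (poisson_grad x \<xi> \<bullet> h) *\<^sub>R \<phi> \<xi>)"
    by (simp add: case_prod_beta)
qed

section \<open>Oscillation under orthogonal maps\<close>

text \<open>The cone over the cap lies in a box of half-width \<open>1\<close> along the axis
  \<open>k\<close> and \<open>t\<close> in every other direction; the volume of this box gives the
  power \<open>t ^ (CARD('n) - 1)\<close>.\<close>

lemma measure_sphere_cap_axis:
  fixes k :: "'n::finite"
  assumes t: "0 < t"
  shows "measure sphere_measure (sphere 0 1 \<inter> cball (axis k 1 :: real^'n) t)
    \<le> 2 ^ CARD('n) / measure lborel (ball (0::real^'n) 1) * t ^ (CARD('n) - 1)"
proof -
  let ?A = "sphere 0 1 \<inter> cball (axis k 1 :: real^'n) t"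
  let ?C = "{r *\<^sub>R \<xi> | r \<xi>. 0 < r \<and> r < 1 \<and> \<xi> \<in> ?A}"
  define b :: "real^'n" where "b = (\<chi> i. if i = k then 1 else t)"
  have "?C \<subseteq> cbox (- b) b"
  proof
    fix y assume "y \<in> ?C"
    then obtain r \<xi> where r: "y = r *\<^sub>R \<xi>" "0 < r" "r < 1" "norm \<xi> = 1" "norm (\<xi> - axis k 1) \<le> t"
      by (auto simp: dist_norm norm_minus_commute)
    have "\<bar>y $ i\<bar> \<le> b $ i" for i
    proof -
      have "\<bar>\<xi> $ i\<bar> \<le> b $ i"
      proof (cases "i = k")
        case True
        then show ?thesis using component_le_norm_cart[of \<xi> i] r by (simp add: b_def)
      next
        \<comment> \<open>The vector \<open>axis k 1\<close> has component \<open>0\<close> in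
          direction \<open>i\<close>, so \<open>\<xi> $ i\<close> is a component of
          \<open>\<xi> - axis k 1\<close>, whose norm is at most \<open>t\<close>.\<close>
        case False
        then show ?thesis using component_le_norm_cart[of "\<xi> - axis k 1" i] r
          by (simp add: b_def axis_def)
      qed
      moreover have "\<bar>y $ i\<bar> \<le> \<bar>\<xi> $ i\<bar>" using r by (simp add: abs_mult mult_left_le_one_le)
      ultimately show ?thesis by simp
    qed
    then show "y \<in> cbox (- b) b" by (auto simp: mem_box_cart abs_le_iff minus_le_iff)
  qed
  then have "emeasure lborel ?C \<le> emeasure lborel (cbox (- b) b)"
    by (intro emeasure_mono) auto
  also have "\<dots> = ennreal (measure lborel (cbox (- b) b))"
    using emeasure_lborel_cbox_finite[of "- b" b] by (intro emeasure_eq_ennreal_measure) auto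
  also have "measure lborel (cbox (- b) b) = (\<Prod>i\<in>UNIV. 2 * b $ i)"
  proof -
    have "b \<in> cbox (- b) b" using t by (auto simp: mem_box_cart b_def)
    then have "cbox (- b) b \<noteq> {}" by blast
    then show ?thesis by (subst content_cbox_cart) auto
  qed
  also have "\<dots> = 2 ^ CARD('n) * (b $ k * (\<Prod>i\<in>UNIV - {k}. b $ i))"
    by (simp add: prod.distrib prod.remove[of UNIV k])
  also have "(\<Prod>i\<in>UNIV - {k}. b $ i) = (\<Prod>i\<in>UNIV - {k}. t)"
    by (intro prod.cong) (auto simp: b_def)
  also have "b $ k * \<dots> = t ^ (CARD('n) - 1)"
    by (simp add: b_def card_Diff_singleton)
  finally have le: "emeasure lborel ?C \<le> ennreal (2 ^ CARD('n) * t ^ (CARD('n) - 1))" .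
  have pos: "0 < measure lborel (ball (0::real^'n) 1)" by (simp add: content_ball_pos)
  have "emeasure sphere_measure ?A = emeasure lborel ?C / emeasure lborel (ball (0::real^'n) 1)"
    by (rule emeasure_sphere_measure) auto
  also have "\<dots> \<le> ennreal (2 ^ CARD('n) * t ^ (CARD('n) - 1)) / ennreal (measure lborel (ball (0::real^'n) 1))"
    using le emeasure_lborel_ball_finite[of "0::real^'n" 1]
    by (auto intro!: divide_right_mono_ennreal simp: emeasure_eq_ennreal_measure less_top[symmetric])
  also have "\<dots> = ennreal (2 ^ CARD('n) / measure lborel (ball (0::real^'n) 1) * t ^ (CARD('n) - 1))"
    using t pos by (subst divide_ennreal) auto
  finally show ?thesis using t pos by (auto simp: measure_def intro!: enn2real_leI)
qed

text \<open>By rotation invariance the centre may be moved to a coordinate axis.\<close>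

lemma measure_sphere_cap:
  fixes e :: "real^'n"
  assumes e: "norm e = 1" and t: "0 < t"
  shows "measure sphere_measure (sphere 0 1 \<inter> cball e t)
    \<le> 2 ^ CARD('n) / measure lborel (ball (0::real^'n) 1) * t ^ (CARD('n) - 1)"
proof -
  fix k :: 'n
  obtain A where A: "orthogonal_matrix A" "A *v axis k 1 = e"
    using orthogonal_matrix_exists_basis[OF e] by metis
  define f where "f = (*v) A"
  have f: "orthogonal_transformation f" "f (axis k 1) = e"
    using A by (simp_all add: f_def orthogonal_transformation_matrix)
  have "measure sphere_measure (sphere 0 1 \<inter> cball e t)
      = measure (distr sphere_measure borel f) (sphere 0 1 \<inter> cball e t)"
    by (simp add: sphere_measure_distr_orthogonal[OF f(1)])
  also have "\<dots> = measure sphere_measure (f -` (sphere 0 1 \<inter> cball e t))"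
    using borel_measurable_orthogonal_transformation[OF f(1)]
    by (subst measure_distr) (auto simp: measurable_cong_sets[OF sets_sphere_measure refl])
  also have "f -` (sphere 0 1 \<inter> cball e t) = sphere 0 1 \<inter> cball (axis k 1) t"
    using f by (auto simp: orthogonal_transformation_norm orthogonal_transformation_isometry
        simp flip: f(2))
  finally show ?thesis using measure_sphere_cap_axis[OF t, of k] by simp
qed

text \<open>
  Dyadic decomposition into the caps of radius \<open>2 ^ k * (1 - norm x)\<close> about the boundary point
  nearest to \<open>x\<close>. The exact value \<open>1\<close> of the integral is not needed.
\<close>

lemma poisson_kernel_integral_bounded:
  obtains M where "0 \<le> M"
    "\<And>x :: real^'n. x \<in> ball 0 1 \<Longrightarrow> (LINT \<xi>:sphere 0 1|sphere_measure. poisson_kernel x \<xi>) \<le> M"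
proof
  let ?S = "sphere (0::real^'n) 1" and ?n = "CARD('n)"
  define C where "C = 2 ^ ?n / measure lborel (ball (0::real^'n) 1)"
  have C: "0 \<le> C" by (simp add: C_def)
  show "0 \<le> 4 * 4 ^ ?n * C" using C by simp
  fix x :: "real^'n" assume "x \<in> ball 0 1"
  then have x: "norm x < 1" by simp
  \<comment> \<open>The boundary point nearest to \<open>x\<close> is \<open>sgn x\<close>; for
    \<open>x = 0\<close> any unit vector serves.\<close>
  obtain e where e: "norm e = 1" "norm (e - x) = 1 - norm x"
  proof (cases "x = 0")
    case True
    then show ?thesis using that[of "axis undefined 1"] by simp
  next
    case False
    then have "sgn x - x = (1 / norm x - 1) *\<^sub>R x"
      by (simp add: sgn_div_norm scaleR_left_diff_distrib inverse_eq_divide)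
    then have "norm (sgn x - x) = 1 - norm x" using x False by (simp add: field_simps)
    then show ?thesis using that[of "sgn x"] False by (simp add: norm_sgn)
  qed
  define \<delta> where "\<delta> = 1 - norm x"
  have \<delta>: "0 < \<delta>" using x by (simp add: \<delta>_def)
  \<comment> \<open>The largest cap has radius \<open>2 ^ N * \<delta>\<close>, which exceeds the
    diameter \<open>2\<close> of the sphere, so it covers the sphere.\<close>
  obtain N :: nat where N: "2 / \<delta> < 2 ^ N" using real_arch_pow[of 2 "2 / \<delta>"] by auto
  \<comment> \<open>This bounds the kernel where \<open>k\<close> is the least index of a cap
    containing \<open>\<xi>\<close>: the numerator is at most \<open>2 * \<delta>\<close>, and
    \<open>norm (x - \<xi>)\<close> is at least \<open>2 ^ k * \<delta> / 4\<close>.\<close>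
  define a where "a k = 2 * 4 ^ ?n * \<delta> / (2 ^ k * \<delta>) ^ ?n" for k :: nat
  define A where "A k = ?S \<inter> cball e (2 ^ k * \<delta>)" for k :: nat
  have a: "0 \<le> a k" for k using \<delta> by (simp add: a_def)
  have P: "poisson_kernel x \<xi> \<le> (\<Sum>k\<le>N. a k * indicator (A k) \<xi>)" if \<xi>: "\<xi> \<in> ?S" for \<xi>
  proof -
    have n\<xi>: "norm \<xi> = 1" using \<xi> by simp
    define s where "s = norm (\<xi> - e)"
    have "s \<le> 2" using norm_triangle_ineq4[of \<xi> e] n\<xi> e by (simp add: s_def)
    also have "\<dots> \<le> 2 ^ N * \<delta>" using N \<delta> by (simp add: field_simps)
    finally have sN: "s \<le> 2 ^ N * \<delta>" .
    define k where "k = (LEAST k. s \<le> 2 ^ k * \<delta>)"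
    have k: "s \<le> 2 ^ k * \<delta>" "k \<le> N" using sN by (auto simp: k_def intro: LeastI Least_le)
    have d1: "\<delta> \<le> norm (x - \<xi>)"
      using norm_triangle_ineq2[of \<xi> x] n\<xi> by (simp add: \<delta>_def norm_minus_commute)
    have d2: "s \<le> 2 * norm (x - \<xi>)"
      using norm_triangle_ineq[of "\<xi> - x" "x - e"] e d1 by (simp add: s_def \<delta>_def norm_minus_commute)
    \<comment> \<open>If \<open>k = Suc j\<close>, minimality of \<open>k\<close> gives
      \<open>2 ^ j * \<delta> < s\<close>, and \<open>d2\<close> loses a further factor
      \<open>2\<close>; hence the \<open>4\<close>.\<close>
    have d: "2 ^ k * \<delta> / 4 \<le> norm (x - \<xi>)"
    proof (cases k)
      case 0
      then show ?thesis using d1 \<delta> by simp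
    next
      case (Suc j)
      then have "\<not> s \<le> 2 ^ j * \<delta>" unfolding k_def by (metis lessI not_less_Least)
      then have "2 ^ j * \<delta> < s" by simp
      moreover have "2 ^ k * \<delta> = 2 * (2 ^ j * \<delta>)" using Suc by simp
      ultimately show ?thesis using d2 by linarith
    qed
    have d0: "0 < norm (x - \<xi>)" using d1 \<delta> by linarith
    have "1 - (norm x)\<^sup>2 = \<delta> * (1 + norm x)"
      by (simp add: \<delta>_def power2_eq_square algebra_simps)
    then have "poisson_kernel x \<xi> = (\<delta> * (1 + norm x)) / norm (x - \<xi>) ^ ?n"
      by (simp add: poisson_kernel_def)
    also have "\<dots> \<le> (\<delta> * 2) / norm (x - \<xi>) ^ ?n"
      using x \<delta> by (intro divide_right_mono mult_left_mono) auto
    also have "\<dots> \<le> (\<delta> * 2) / (2 ^ k * \<delta> / 4) ^ ?n"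
      using d d0 \<delta> by (intro divide_left_mono power_mono mult_pos_pos) auto
    also have "\<dots> = a k * indicator (A k) \<xi>"
      using k \<xi> by (simp add: a_def A_def power_divide s_def dist_norm norm_minus_commute)
    also have "\<dots> \<le> (\<Sum>k\<le>N. a k * indicator (A k) \<xi>)"
      using k a by (intro member_le_sum) auto
    finally show ?thesis .
  qed
  have int: "integrable sphere_measure (\<lambda>\<xi>. a k * indicator (A k) \<xi>)" for k
    by (intro integrable_mult_right) (auto simp: A_def
       finite_measure.emeasure_finite[OF finite_measure_sphere_measure] less_top[symmetric])
  have "(LINT \<xi>:?S|sphere_measure. poisson_kernel x \<xi>)
      \<le> (LINT \<xi>|sphere_measure. (\<Sum>k\<le>N. a k * indicator (A k) \<xi>))"
    unfolding set_lebesgue_integral_def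
  proof (rule integral_mono)
    show "integrable sphere_measure (\<lambda>\<xi>. indicator ?S \<xi> *\<^sub>R poisson_kernel x \<xi>)"
      using set_integrable_sphere_measure[OF continuous_on_slice[OF continuous_on_poisson_kernel]] x
      by (simp add: set_integrable_def)
    show "integrable sphere_measure (\<lambda>\<xi>. \<Sum>k\<le>N. a k * indicator (A k) \<xi>)"
      using int by (intro Bochner_Integration.integrable_sum)
    show "indicator ?S \<xi> *\<^sub>R poisson_kernel x \<xi> \<le> (\<Sum>k\<le>N. a k * indicator (A k) \<xi>)" for \<xi>
      using P[of \<xi>] a by (auto simp: indicator_def intro!: sum_nonneg)
  qed
  also have "\<dots> = (\<Sum>k\<le>N. a k * measure sphere_measure (A k))"
    using int by (subst Bochner_Integration.integral_sum) auto
  also have "\<dots> \<le> (\<Sum>k\<le>N. a k * (C * (2 ^ k * \<delta>) ^ (?n - 1)))"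
    unfolding A_def C_def using \<delta> e a
    by (intro sum_mono mult_left_mono measure_sphere_cap) auto
  \<comment> \<open>One factor \<open>2 ^ k * \<delta>\<close> remains in the denominator, and its
    \<open>\<delta>\<close> cancels the one in the numerator of \<open>a k\<close>. The geometric
    sum that is left has a bound independent of \<open>x\<close> and \<open>N\<close>.\<close>
  also have "\<dots> = (\<Sum>k\<le>N. 2 * 4 ^ ?n * C * (1 / 2) ^ k)"
  proof (rule sum.cong)
    fix k
    obtain m where m: "?n = Suc m" using not0_implies_Suc[of ?n] by auto
    show "a k * (C * (2 ^ k * \<delta>) ^ (?n - 1)) = 2 * 4 ^ ?n * C * (1 / 2) ^ k"
      using \<delta> by (simp add: a_def m power_divide field_simps)
  qed simp
  also have "\<dots> = 2 * 4 ^ ?n * C * (\<Sum>k\<le>N. (1 / 2) ^ k)" by (simp add: sum_distrib_left)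
  also have "\<dots> \<le> 2 * 4 ^ ?n * C * 2"
  proof (intro mult_left_mono)
    have "(\<Sum>k\<le>N. (1 / 2 :: real) ^ k) \<le> (\<Sum>k. (1 / 2) ^ k)"
      by (intro sum_le_suminf) (auto intro: summable_geometric)
    then show "(\<Sum>k\<le>N. (1 / 2 :: real) ^ k) \<le> 2" by (simp add: suminf_geometric)
  qed (use C in simp)
  finally show "(LINT \<xi>:?S|sphere_measure. poisson_kernel x \<xi>) \<le> 4 * 4 ^ ?n * C" by simp
qed

text \<open>The kernel equals \<open>1\<close> at \<open>x = 0\<close>, and its gradient is bounded
  on the compact product of the half ball and the sphere, so the mean value inequality
  applies.\<close>

lemma poisson_kernel_near_0:
  obtains C where "0 \<le> C" "\<And>x \<xi> :: real^'n. norm x \<le> 1/2 \<Longrightarrow> norm \<xi> = 1 \<Longrightarrow>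
    \<bar>poisson_kernel x \<xi> - 1\<bar> \<le> C * norm x"
proof -
  let ?K = "cball (0::real^'n) (1/2) \<times> sphere (0::real^'n) 1"
  have "continuous_on ?K (\<lambda>(x, \<xi>). poisson_grad x \<xi>)"
    by (rule continuous_on_subset[OF continuous_on_poisson_grad]) auto
  moreover have "compact ?K" by (intro compact_Times) auto
  ultimately obtain C where C: "0 < C" "\<And>z. z \<in> ?K \<Longrightarrow> norm ((\<lambda>(x, \<xi>). poisson_grad x \<xi>) z) \<le> C"
    using compact_continuous_norm_bound by blast
  show thesis
  proof
    fix x \<xi> :: "real^'n" assume x: "norm x \<le> 1/2" and \<xi>: "norm \<xi> = 1"
    have "norm (poisson_kernel x \<xi> - poisson_kernel 0 \<xi>) \<le> C * norm (x - 0)"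
    proof (rule differentiable_bound[where S = "cball 0 (1/2)" and f' = "\<lambda>x h. poisson_grad x \<xi> \<bullet> h"])
      fix y :: "real^'n" assume y: "y \<in> cball 0 (1/2)"
      then have "y \<noteq> \<xi>" using \<xi> by auto
      then show "((\<lambda>x. poisson_kernel x \<xi>) has_derivative (\<lambda>h. poisson_grad y \<xi> \<bullet> h)) (at y within cball 0 (1/2))"
        by (rule has_derivative_at_withinI[OF has_derivative_poisson_kernel])
      have "norm (poisson_grad y \<xi>) \<le> C" using C(2)[of "(y, \<xi>)"] y \<xi> by simp
      then show "onorm (\<lambda>h. poisson_grad y \<xi> \<bullet> h) \<le> C"
        by (rule onorm_inner_le)
    qed (use x in auto)
    then show "\<bar>poisson_kernel x \<xi> - 1\<bar> \<le> C * norm x" using \<xi> by (simp add: poisson_kernel_def)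
  qed (use C in auto)
qed

text \<open>
  The factor \<open>norm x\<close> survives at the origin because \<open>\<phi> \<circ> f - \<phi>\<close> has
  mean value \<open>0\<close>, so that the kernel may be replaced by \<open>P(x, \<xi>) - 1\<close> there.
\<close>

lemma poisson_integral_orthogonal_oscillation:
  obtains T where "0 \<le> T"
    "\<And>(\<phi> :: real^'n \<Rightarrow> real^'n) f c x. continuous_on (sphere 0 1) \<phi> \<Longrightarrow> orthogonal_transformation f \<Longrightarrow>
      (\<And>\<xi>. norm \<xi> = 1 \<Longrightarrow> norm (\<phi> (f \<xi>) - \<phi> \<xi>) \<le> c) \<Longrightarrow> x \<in> ball 0 1 \<Longrightarrow>
      norm (poisson_integral \<phi> (f x) - poisson_integral \<phi> x) \<le> T * c * norm x"
proof -
  obtain M where M: "0 \<le> M"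
    "\<And>x :: real^'n. x \<in> ball 0 1 \<Longrightarrow> (LINT \<xi>:sphere 0 1|sphere_measure. poisson_kernel x \<xi>) \<le> M"
    using poisson_kernel_integral_bounded by blast
  obtain C where C: "0 \<le> C" "\<And>x \<xi> :: real^'n. norm x \<le> 1/2 \<Longrightarrow> norm \<xi> = 1 \<Longrightarrow>
    \<bar>poisson_kernel x \<xi> - 1\<bar> \<le> C * norm x"
    using poisson_kernel_near_0 by blast
  show thesis
  proof
    \<comment> \<open>The summand \<open>C\<close> serves \<open>norm x \<le> 1/2\<close>; the
      summand \<open>2 * M\<close> serves the rest of the ball, where
      \<open>1 \<le> 2 * norm x\<close>.\<close>
    show "0 \<le> C + 2 * M" using C M by simp
    fix \<phi> :: "real^'n \<Rightarrow> real^'n" and f :: "real^'n \<Rightarrow> real^'n" and c :: real and x :: "real^'n"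
    assume \<phi>: "continuous_on (sphere 0 1) \<phi>" and f: "orthogonal_transformation f"
      and c: "\<And>\<xi>. norm \<xi> = 1 \<Longrightarrow> norm (\<phi> (f \<xi>) - \<phi> \<xi>) \<le> c" and x: "x \<in> ball 0 1"
    let ?S = "sphere (0::real^'n) 1"
    have c0: "0 \<le> c" by (rule order_trans[OF norm_ge_zero c[of "axis undefined 1"]]) simp
    have fx: "f x \<in> ball 0 1" using f x by (simp add: orthogonal_transformation_norm)
    note P = continuous_on_slice[OF continuous_on_poisson_kernel]
    have \<phi>f: "continuous_on ?S (\<lambda>\<xi>. \<phi> (f \<xi>))"
      using f by (intro continuous_on_compose2[OF \<phi>] linear_continuous_on)
        (auto simp: orthogonal_transformation_norm orthogonal_transformation_linear linear_linear)
    have Pf: "poisson_kernel (f x) (f \<xi>) = poisson_kernel x \<xi>" for \<xi>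
      using f by (simp add: poisson_kernel_def orthogonal_transformation_norm
          orthogonal_transformation_linear flip: linear_diff)
    \<comment> \<open>Substituting \<open>f \<xi>\<close> for \<open>\<xi>\<close> and using
      \<open>Pf\<close> moves the rotation from the point \<open>x\<close> to the boundary
      function.\<close>
    have "poisson_integral \<phi> (f x) = (LINT \<xi>:?S|sphere_measure. poisson_kernel (f x) (f \<xi>) *\<^sub>R \<phi> (f \<xi>))"
      unfolding poisson_integral_def
      by (rule set_integral_sphere_orthogonal[OF f, symmetric]) (intro continuous_intros \<phi> P fx)
    then have u: "poisson_integral \<phi> (f x) - poisson_integral \<phi> x =
        (LINT \<xi>:?S|sphere_measure. poisson_kernel x \<xi> *\<^sub>R (\<phi> (f \<xi>) - \<phi> \<xi>))"
      unfolding Pf scaleR_diff_right poisson_integral_def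
      by (subst set_integral_diff(2)) (auto intro!: set_integrable_sphere_measure continuous_intros P x \<phi> \<phi>f)
    have CM: "C * c * norm x \<le> (C + 2 * M) * c * norm x" "2 * M * c * norm x \<le> (C + 2 * M) * c * norm x"
      using C M c0 by (auto simp: distrib_right)
    show "norm (poisson_integral \<phi> (f x) - poisson_integral \<phi> x) \<le> (C + 2 * M) * c * norm x"
    proof (cases "norm x \<le> 1/2")
      case True
      have "(LINT \<xi>:?S|sphere_measure. \<phi> (f \<xi>) - \<phi> \<xi>) = 0"
        by (subst set_integral_diff(2)) (auto intro!: set_integrable_sphere_measure \<phi> \<phi>f
            simp: set_integral_sphere_orthogonal[OF f \<phi>])
      then have "poisson_integral \<phi> (f x) - poisson_integral \<phi> x =
        (LINT \<xi>:?S|sphere_measure. poisson_kernel x \<xi> *\<^sub>R (\<phi> (f \<xi>) - \<phi> \<xi>)) -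
        (LINT \<xi>:?S|sphere_measure. \<phi> (f \<xi>) - \<phi> \<xi>)" using u by simp
      also have "\<dots> = (LINT \<xi>:?S|sphere_measure. poisson_kernel x \<xi> *\<^sub>R (\<phi> (f \<xi>) - \<phi> \<xi>) - (\<phi> (f \<xi>) - \<phi> \<xi>))"
        by (subst set_integral_diff(2)) (auto intro!: set_integrable_sphere_measure continuous_intros P x \<phi> \<phi>f)
      also have "\<dots> = (LINT \<xi>:?S|sphere_measure. (poisson_kernel x \<xi> - 1) *\<^sub>R (\<phi> (f \<xi>) - \<phi> \<xi>))"
        by (simp add: scaleR_left_diff_distrib)
      also have "norm \<dots> \<le> C * norm x * c"
      proof (rule norm_set_integral_sphere_le)
        show "continuous_on ?S (\<lambda>\<xi>. (poisson_kernel x \<xi> - 1) *\<^sub>R (\<phi> (f \<xi>) - \<phi> \<xi>))"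
          by (intro continuous_intros P x \<phi> \<phi>f)
        show "norm ((poisson_kernel x \<xi> - 1) *\<^sub>R (\<phi> (f \<xi>) - \<phi> \<xi>)) \<le> C * norm x * c" if "\<xi> \<in> ?S" for \<xi>
          using C c[of \<xi>] True that by (auto intro!: mult_mono)
      qed (use C c0 in auto)
      finally show ?thesis using CM by (simp add: mult_ac)
    next
      case False
      have P0: "0 \<le> poisson_kernel x \<xi>" for \<xi>
        using x by (simp add: poisson_kernel_def power_le_one)
      have "norm (LINT \<xi>:?S|sphere_measure. poisson_kernel x \<xi> *\<^sub>R (\<phi> (f \<xi>) - \<phi> \<xi>))
        \<le> (LINT \<xi>:?S|sphere_measure. norm (poisson_kernel x \<xi> *\<^sub>R (\<phi> (f \<xi>) - \<phi> \<xi>)))"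
        by (intro set_integral_norm_bound set_integrable_sphere_measure continuous_intros P x \<phi> \<phi>f)
      also have "\<dots> \<le> (LINT \<xi>:?S|sphere_measure. poisson_kernel x \<xi> * c)"
        using c P0 by (intro set_integral_mono set_integrable_sphere_measure continuous_intros P x \<phi> \<phi>f)
          (auto intro!: mult_left_mono)
      also have "\<dots> = (LINT \<xi>:?S|sphere_measure. poisson_kernel x \<xi>) * c" by simp
      also have "\<dots> \<le> M * c" using M(2)[OF x] c0 by (intro mult_right_mono)
      also have "\<dots> \<le> M * c * (2 * norm x)"
        using mult_left_mono[of 1 "2 * norm x" "M * c"] False M(1) c0 by simp
      finally show ?thesis using CM u by (simp add: mult_ac)
    qed
  qed
qed

section \<open>Determinants and plane rotations\<close>

text \<open>Each of the \<open>n!\<close> products in the Leibniz formula takes one entry from every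
  column, and an entry is at most the norm of its column.\<close>

lemma abs_det_le_column_norms:
  fixes A :: "real^'n^'n"
  assumes b: "\<And>j. norm (column j A) \<le> b j"
  shows "\<bar>det A\<bar> \<le> fact CARD('n) * (\<Prod>j\<in>UNIV. b j)"
proof -
  let ?P = "{p. p permutes (UNIV::'n set)}"
  have e: "\<bar>A $ i $ j\<bar> \<le> b j" for i j
    using component_le_norm_cart[of "column j A" i] b[of j] by (simp add: column_def)
  have "\<bar>det A\<bar> \<le> (\<Sum>p\<in>?P. \<bar>of_int (sign p) * (\<Prod>i\<in>UNIV. A $ i $ p i)\<bar>)"
    unfolding det_def by (rule sum_abs)
  also have "\<dots> \<le> (\<Sum>p\<in>?P. \<Prod>j\<in>UNIV. b j)"
  proof (rule sum_mono)
    fix p assume p: "p \<in> ?P"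
    have "\<bar>of_int (sign p) * (\<Prod>i\<in>UNIV. A $ i $ p i)\<bar> = (\<Prod>i\<in>UNIV. \<bar>A $ i $ p i\<bar>)"
      by (simp add: abs_mult abs_prod sign_def)
    also have "\<dots> \<le> (\<Prod>i\<in>UNIV. b (p i))" using e by (intro prod_mono) auto
    also have "\<dots> = (\<Prod>j\<in>UNIV. b j)"
      using p by (intro prod.reindex_bij_betw permutes_imp_bij) auto
    finally show "\<bar>of_int (sign p) * (\<Prod>i\<in>UNIV. A $ i $ p i)\<bar> \<le> (\<Prod>j\<in>UNIV. b j)" .
  qed
  also have "\<dots> = fact CARD('n) * (\<Prod>j\<in>UNIV. b j)"
    by (simp add: card_permutations)
  finally show ?thesis .
qed

text \<open>Extend \<open>e\<close> to an orthonormal basis, the columns of \<open>Q\<close>. Then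
  \<open>D ** Q\<close> has the same determinant up to sign, and its columns are the images of the
  basis vectors under \<open>D\<close>.\<close>

lemma abs_det_le_directional:
  fixes D :: "real^'n^'n"
  assumes e: "norm e = 1"
    and N: "norm (D *v e) \<le> N"
    and T: "\<And>v. v \<bullet> e = 0 \<Longrightarrow> norm v = 1 \<Longrightarrow> norm (D *v v) \<le> T"
  shows "\<bar>det D\<bar> \<le> fact CARD('n) * (N * T ^ (CARD('n) - 1))"
proof -
  fix k :: 'n
  obtain Q where Q: "orthogonal_matrix Q" "Q *v axis k 1 = e"
    using orthogonal_matrix_exists_basis[OF e] by metis
  have ot: "orthogonal_transformation ((*v) Q)"
    using Q by (simp add: orthogonal_transformation_matrix)
  have "\<bar>det Q\<bar> = 1" using det_orthogonal_matrix[OF Q(1)] by auto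
  then have "\<bar>det D\<bar> = \<bar>det (D ** Q)\<bar>" by (simp add: det_mul abs_mult)
  also have "\<dots> \<le> fact CARD('n) * (\<Prod>j\<in>UNIV. if j = k then N else T)"
  proof (rule abs_det_le_column_norms)
    fix j
    define q where "q = Q *v axis j 1"
    have c: "column j (D ** Q) = D *v q"
      unfolding q_def by (metis matrix_vector_mul_assoc matrix_vector_mult_basis)
    show "norm (column j (D ** Q)) \<le> (if j = k then N else T)"
    proof (cases "j = k")
      case True
      then have "q = e" using Q(2) by (simp only: q_def)
      then show ?thesis unfolding c using N True by simp
    next
      case False
      have "q \<bullet> e = axis j 1 \<bullet> (axis k 1 :: real^'n)"
        using ot unfolding q_def Q(2)[symmetric] orthogonal_transformation_def by (elim conjE allE)
      then have "q \<bullet> e = 0" using False by (simp add: inner_axis_axis)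
      moreover have "norm q = 1"
        unfolding q_def orthogonal_transformation_norm[OF ot] by simp
      ultimately have "norm (D *v q) \<le> T" by (rule T)
      then show ?thesis unfolding c using False by simp
    qed
  qed
  also have "(\<Prod>j\<in>UNIV. if j = k then N else T) = N * (\<Prod>j\<in>UNIV - {k}. if j = k then N else T)"
    by (subst prod.remove[of UNIV k]) auto
  also have "(\<Prod>j\<in>UNIV - {k}. if j = k then N else T) = (\<Prod>j\<in>UNIV - {k}. T)"
    by (intro prod.cong) auto
  also have "\<dots> = T ^ (CARD('n) - 1)" by (simp add: card_Diff_singleton)
  finally show ?thesis .
qed

text \<open>With \<open>N\<close> the operator norm and \<open>n\<close> the dimension, the
  determinant bound gives \<open>N ^ n \<le> K * n! * N * T ^ (n - 1)\<close>. Dividing by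
  \<open>N\<close> and taking a root of order \<open>n - 1\<close>, which is positive for
  \<open>n \<ge> 2\<close>, bounds \<open>N\<close>.\<close>

lemma onorm_le_of_quasiconformal:
  fixes D :: "real^'n^'n"
  assumes n: "2 \<le> CARD('n)" and K: "1 \<le> K" and T0: "0 \<le> T"
    and qc: "onorm ((*v) D) ^ CARD('n) \<le> K * det D"
    and e: "norm e = 1" and T: "\<And>v. v \<bullet> e = 0 \<Longrightarrow> norm v = 1 \<Longrightarrow> norm (D *v v) \<le> T"
  shows "onorm ((*v) D) \<le> K * fact CARD('n) * T"
proof (cases "onorm ((*v) D) = 0")
  case True
  then show ?thesis using K T0 by simp
next
  case False
  define N where "N = onorm ((*v) D)"
  have N: "0 < N" using False onorm_pos_le[OF matrix_vector_mul_bounded_linear[of D]]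
    by (simp add: N_def)
  obtain m where m: "CARD('n) = Suc (Suc m)"
    using n by (metis Suc_le_D numeral_2_eq_2 Suc_le_mono)
  let ?c = "K * fact CARD('n)"
  have c: "1 \<le> ?c" using mult_mono[of 1 K 1 "fact CARD('n)"] K fact_ge_1[of "CARD('n)"] by simp
  have "norm (D *v e) \<le> N"
    using onorm[OF matrix_vector_mul_bounded_linear[of D], of e] e by (simp add: N_def)
  then have "\<bar>det D\<bar> \<le> fact CARD('n) * (N * T ^ (CARD('n) - 1))"
    using e T by (intro abs_det_le_directional)
  then have "K * det D \<le> K * (fact CARD('n) * (N * T ^ (CARD('n) - 1)))"
    using K by (intro mult_left_mono) auto
  with qc have "N * N ^ Suc m \<le> N * (?c * T ^ Suc m)"
    by (simp add: N_def m mult_ac)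
  then have "N ^ Suc m \<le> ?c * T ^ Suc m" using N by (rule mult_left_le_imp_le)
  \<comment> \<open>Since \<open>?c\<close> is at least \<open>1\<close>, raising it to the power
    \<open>Suc m\<close> only enlarges it and makes the right-hand side a perfect power.\<close>
  also have "\<dots> \<le> ?c ^ Suc m * T ^ Suc m"
    using c T0 power_increasing[of 1 "Suc m" ?c] by (intro mult_right_mono) auto
  also have "\<dots> = (?c * T) ^ Suc m" by (simp only: power_mult_distrib)
  finally show ?thesis unfolding N_def[symmetric]
    by (rule power_le_imp_le_base) (use c T0 in simp)
qed

section \<open>Rotations in a plane\<close>

text \<open>For orthonormal \<open>e\<close> and \<open>w\<close> this is the rotation by the angle
  \<open>t\<close> from \<open>e\<close> towards \<open>w\<close>, fixing the orthogonal complement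
  of their plane. Writing it as the identity plus a correction avoids choosing a basis.\<close>

definition plane_rotation :: "'a::real_inner \<Rightarrow> 'a \<Rightarrow> real \<Rightarrow> 'a \<Rightarrow> 'a" where
  "plane_rotation e w t z = z + ((cos t - 1) * (z \<bullet> e) - sin t * (z \<bullet> w)) *\<^sub>R e
     + (sin t * (z \<bullet> e) + (cos t - 1) * (z \<bullet> w)) *\<^sub>R w"

lemma orthogonal_plane_rotation:
  fixes e w :: "'a::euclidean_space"
  assumes e: "norm e = 1" "norm w = 1" "e \<bullet> w = 0"
  shows "orthogonal_transformation (plane_rotation e w t)"
  unfolding orthogonal_transformation
proof (intro conjI allI)
  show "linear (plane_rotation e w t)"
    by (rule linearI) (auto simp: plane_rotation_def inner_add_left algebra_simps scaleR_add_left)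
  fix z
  have e': "e \<bullet> e = 1" "w \<bullet> w = 1" "w \<bullet> e = 0" using e by (auto simp: dot_square_norm inner_commute)
  define p q c s where pq: "p = z \<bullet> e" "q = z \<bullet> w" "c = cos t" "s = sin t"
  have cs: "s * s = 1 - c * c" using sin_cos_squared_add[of t] by (simp add: pq power2_eq_square)
  have *: "plane_rotation e w t z \<bullet> plane_rotation e w t z = z \<bullet> z
      + 2 * ((c - 1) * p - s * q) * p + 2 * (s * p + (c - 1) * q) * q
      + ((c - 1) * p - s * q) * ((c - 1) * p - s * q) + (s * p + (c - 1) * q) * (s * p + (c - 1) * q)"
    unfolding plane_rotation_def pq[symmetric] inner_add_left inner_add_right inner_scaleR_left
      inner_scaleR_right e' e(3) inner_commute[of e z] inner_commute[of w z]
    by (simp add: algebra_simps)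
  \<comment> \<open>The mixed terms in \<open>p * q\<close> cancel.\<close>
  have "\<dots> = z \<bullet> z + (s * s + c * c - 1) * (p * p + q * q)"
    by (simp add: algebra_simps)
  also have "\<dots> = z \<bullet> z" by (simp add: cs)
  finally show "norm (plane_rotation e w t z) = norm z"
    using * by (simp add: norm_eq_sqrt_inner)
qed

text \<open>The displacement has four scalar terms, each at most
  \<open>\<bar>t\<bar> * norm z\<close>; hence the constant \<open>4\<close>.\<close>

lemma norm_plane_rotation_diff:
  fixes e w :: "'a::real_inner"
  assumes e: "norm e = 1" "norm w = 1"
  shows "norm (plane_rotation e w t z - z) \<le> 4 * \<bar>t\<bar> * norm z"
proof -
  have s: "\<bar>sin t\<bar> \<le> \<bar>t\<bar>" by (rule abs_sin_x_le_abs_x)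
  have c: "\<bar>cos t - 1\<bar> \<le> \<bar>t\<bar>"
  proof -
    have "cos t - 1 = - 2 * (sin (t / 2))\<^sup>2" using cos_double_sin[of "t / 2"] by simp
    then have "\<bar>cos t - 1\<bar> = 2 * (\<bar>sin (t / 2)\<bar> * \<bar>sin (t / 2)\<bar>)"
      by (simp add: abs_mult power2_eq_square)
    also have "\<dots> \<le> 2 * (\<bar>t / 2\<bar> * 1)"
      using abs_sin_x_le_abs_x[of "t / 2"] abs_sin_le_one[of "t / 2"] by (intro mult_left_mono mult_mono) auto
    finally show ?thesis by simp
  qed
  have ip: "\<bar>z \<bullet> e\<bar> \<le> norm z" "\<bar>z \<bullet> w\<bar> \<le> norm z"
    using Cauchy_Schwarz_ineq2[of z e] Cauchy_Schwarz_ineq2[of z w] e by simp_all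
  have b: "\<bar>(cos t - 1) * (z \<bullet> e)\<bar> \<le> \<bar>t\<bar> * norm z" "\<bar>sin t * (z \<bullet> w)\<bar> \<le> \<bar>t\<bar> * norm z"
    "\<bar>(cos t - 1) * (z \<bullet> w)\<bar> \<le> \<bar>t\<bar> * norm z" "\<bar>sin t * (z \<bullet> e)\<bar> \<le> \<bar>t\<bar> * norm z"
    using s c ip by (auto simp: abs_mult intro!: mult_mono)
  have "norm (plane_rotation e w t z - z) \<le>
      norm (((cos t - 1) * (z \<bullet> e) - sin t * (z \<bullet> w)) *\<^sub>R e)
      + norm ((sin t * (z \<bullet> e) + (cos t - 1) * (z \<bullet> w)) *\<^sub>R w)"
    unfolding plane_rotation_def by (rule order_trans[OF _ norm_triangle_ineq]) simp
  also have "\<dots> \<le> 4 * \<bar>t\<bar> * norm z" 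
    using b e unfolding norm_scaleR real_norm_def by (simp only: mult_1_right) linarith
  finally show ?thesis .
qed

text \<open>The derivative is the limit of difference quotients whose norms are at most
  \<open>B\<close>.\<close>

lemma norm_vector_derivative_le:
  fixes g :: "real \<Rightarrow> 'a::real_normed_vector"
  assumes g: "(g has_vector_derivative D) (at 0)" and B: "\<And>t. norm (g t - g 0) \<le> B * \<bar>t\<bar>"
  shows "norm D \<le> B"
proof (rule field_le_epsilon)
  fix e :: real assume "0 < e"
  then obtain d where d: "0 < d" "\<And>t. \<bar>t\<bar> < d \<Longrightarrow> norm (g t - g 0 - t *\<^sub>R D) \<le> e * \<bar>t\<bar>"
    using g unfolding has_vector_derivative_def has_derivative_at_alt by fastforce
  define t where "t = d / 2"
  have t: "0 < t" "t < d" using d by (auto simp: t_def)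
  have "t * norm D = norm (t *\<^sub>R D)" using t by simp
  also have "\<dots> \<le> norm (g t - g 0) + norm (g t - g 0 - t *\<^sub>R D)"
    using norm_triangle_ineq4[of "g t - g 0" "g t - g 0 - t *\<^sub>R D"] by simp
  also have "\<dots> \<le> t * (B + e)" using d(2)[of t] B[of t] t by (simp add: algebra_simps)
  finally show "norm D \<le> B + e" using t by simp
qed

text \<open>By continuity the bound would fail on an open set, and a nonempty open set is not
  negligible.\<close>

lemma AE_le_imp_le_on_open:
  fixes f :: "'a::euclidean_space \<Rightarrow> real"
  assumes G: "open G" and f: "continuous_on G f"
    and ae: "AE x in lebesgue. x \<in> G \<longrightarrow> f x \<le> c" and x: "x \<in> G"
  shows "f x \<le> c"
proof (rule ccontr)
  assume "\<not> f x \<le> c"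
  let ?W = "G \<inter> f -` {c<..}"
  have W: "open ?W" using continuous_open_preimage[OF f G] by simp
  have "?W \<noteq> {}" using x \<open>\<not> f x \<le> c\<close> by auto
  moreover have "negligible ?W"
  proof -
    obtain N where N: "{x. \<not> (x \<in> G \<longrightarrow> f x \<le> c)} \<subseteq> N" "N \<in> null_sets lebesgue"
      using ae by (auto elim!: AE_E simp: null_sets_def)
    have "negligible N" using N(2) by (simp add: negligible_iff_null_sets)
    then show ?thesis by (rule negligible_subset) (use N(1) in auto)
  qed
  ultimately show False using open_not_negligible[OF W] by blast
qed

section \<open>Tangential derivatives and the Lipschitz bound\<close>

text \<open>Rotating \<open>x\<close> towards \<open>v\<close> traces a curve with initial velocity
  \<open>norm x *\<^sub>R v\<close>. The oscillation estimate bounds the difference quotients of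
  \<open>u\<close> along it by a multiple of \<open>norm x\<close>, and this factor cancels.\<close>

lemma norm_derivative_poisson_integral_orthogonal_le:
  obtains T where "0 \<le> T"
    "\<And>(\<phi> :: real^'n \<Rightarrow> real^'n) L x D v. L-lipschitz_on (sphere 0 1) \<phi> \<Longrightarrow> x \<in> ball 0 1 \<Longrightarrow> x \<noteq> 0 \<Longrightarrow>
      (poisson_integral \<phi> has_derivative D) (at x) \<Longrightarrow> v \<bullet> x = 0 \<Longrightarrow> norm v = 1 \<Longrightarrow>
      norm (D v) \<le> T * L"
proof -
  obtain T where T: "0 \<le> T"
    "\<And>(\<phi> :: real^'n \<Rightarrow> real^'n) f c x. continuous_on (sphere 0 1) \<phi> \<Longrightarrow> orthogonal_transformation f \<Longrightarrow>
      (\<And>\<xi>. norm \<xi> = 1 \<Longrightarrow> norm (\<phi> (f \<xi>) - \<phi> \<xi>) \<le> c) \<Longrightarrow> x \<in> ball 0 1 \<Longrightarrow>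
      norm (poisson_integral \<phi> (f x) - poisson_integral \<phi> x) \<le> T * c * norm x"
    using poisson_integral_orthogonal_oscillation by blast
  show thesis
  proof
    show "0 \<le> 4 * T" using T by simp
    fix \<phi> :: "real^'n \<Rightarrow> real^'n" and L x D v
    assume \<phi>: "L-lipschitz_on (sphere 0 1) \<phi>" and x: "x \<in> ball 0 1" "x \<noteq> 0"
      and D: "(poisson_integral \<phi> has_derivative D) (at x)" and v: "v \<bullet> x = 0" "norm v = 1"
    let ?u = "poisson_integral \<phi>"
    define e where "e = sgn x"
    have e: "norm e = 1" "e \<bullet> v = 0" "x = norm x *\<^sub>R e"
      using x v by (auto simp: e_def norm_sgn sgn_div_norm inner_commute)
    have v': "v \<bullet> v = 1" using v by (simp add: dot_square_norm)
    let ?R = "plane_rotation e v"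
    have R: "orthogonal_transformation (?R t)" for t
      using e v by (intro orthogonal_plane_rotation)
    have Rx: "?R t x = cos t *\<^sub>R x + (norm x * sin t) *\<^sub>R v" for t
    proof -
      have xe: "x \<bullet> e = norm x" "x \<bullet> v = 0"
        using v e(1) inner_scaleR_left[of "norm x" e e] by (simp_all add: inner_commute dot_square_norm flip: e(3))
      have "?R t x = x + ((cos t - 1) * norm x) *\<^sub>R e + (sin t * norm x) *\<^sub>R v"
        by (simp add: plane_rotation_def xe)
      also have "((cos t - 1) * norm x) *\<^sub>R e = (cos t - 1) *\<^sub>R x"
        using e(3) by (metis scaleR_scaleR)
      finally show ?thesis by (simp add: algebra_simps)
    qed
    have "((\<lambda>t. cos t *\<^sub>R x + (norm x * sin t) *\<^sub>R v) has_vector_derivative norm x *\<^sub>R v) (at 0)"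
      by (auto intro!: derivative_eq_intros)
    moreover have "(?u has_derivative D) (at (cos 0 *\<^sub>R x + (norm x * sin 0) *\<^sub>R v))" using D by simp
    ultimately have "((\<lambda>t. ?u (cos t *\<^sub>R x + (norm x * sin t) *\<^sub>R v)) has_vector_derivative D (norm x *\<^sub>R v)) (at 0)"
      using vector_derivative_diff_chain_within[of "\<lambda>t. cos t *\<^sub>R x + (norm x * sin t) *\<^sub>R v" "norm x *\<^sub>R v" 0 UNIV ?u D]
      by (auto simp: o_def intro: has_derivative_at_withinI)
    then have "((\<lambda>t. ?u (?R t x)) has_vector_derivative D (norm x *\<^sub>R v)) (at 0)"
      by (simp add: Rx)
    then have "norm (D (norm x *\<^sub>R v)) \<le> 4 * T * L * norm x"
    proof (rule norm_vector_derivative_le)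
      fix t :: real
      have L0: "0 \<le> L" using \<phi> by (rule lipschitz_on_nonneg)
      \<comment> \<open>A rotation by \<open>t\<close> moves unit vectors by at most
        \<open>4 * \<bar>t\<bar>\<close>, so the Lipschitz condition supplies the oscillation
        \<open>L * (4 * \<bar>t\<bar>)\<close> of the boundary function.\<close>
      have "norm (?u (?R t x) - ?u x) \<le> T * (L * (4 * \<bar>t\<bar>)) * norm x"
      proof (rule T(2)[OF lipschitz_on_continuous_on[OF \<phi>] R _ x(1)])
        fix \<xi> :: "real^'n" assume \<xi>: "norm \<xi> = 1"
        have "norm (\<phi> (?R t \<xi>) - \<phi> \<xi>) \<le> L * norm (?R t \<xi> - \<xi>)"
          using lipschitz_onD[OF \<phi>, of "?R t \<xi>" \<xi>] \<xi> orthogonal_transformation_norm[OF R, of t \<xi>]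
          by (simp add: dist_norm)
        also have "\<dots> \<le> L * (4 * \<bar>t\<bar>)"
          using norm_plane_rotation_diff[OF e(1) v(2), of t \<xi>] \<xi> L0 by (intro mult_left_mono) auto
        finally show "norm (\<phi> (?R t \<xi>) - \<phi> \<xi>) \<le> L * (4 * \<bar>t\<bar>)" .
      qed
      then show "norm (?u (?R t x) - ?u (?R 0 x)) \<le> 4 * T * L * norm x * \<bar>t\<bar>"
        by (simp add: Rx mult_ac)
    qed
    moreover have "D (norm x *\<^sub>R v) = norm x *\<^sub>R D v"
      using has_derivative_linear[OF D] by (rule linear_cmul)
    ultimately have "norm x * norm (D v) \<le> norm x * (4 * T * L)" by (simp add: mult_ac)
    then show "norm (D v) \<le> 4 * T * L" 
      by (rule mult_left_le_imp_le) (use x in simp)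
  qed
qed

text \<open>At a point of differentiability \<open>vector_derivative\<close> gives the true partial
  derivatives, so no arbitrary default value enters.\<close>

lemma formal_deriv_eq_matrix:
  assumes D: "(f has_derivative D) (at x)"
  shows "formal_deriv f x = matrix D"
proof -
  have "partial_deriv f i x = D (axis i 1)" for i
  proof -
    have "((\<lambda>t. x + t *\<^sub>R axis i 1) has_vector_derivative axis i 1) (at 0)"
      by (auto intro!: derivative_eq_intros)
    then have "((\<lambda>t. f (x + t *\<^sub>R axis i 1)) has_vector_derivative D (axis i 1)) (at 0)"
      using vector_derivative_diff_chain_within[of "\<lambda>t. x + t *\<^sub>R axis i 1" "axis i 1" 0 UNIV f D] D
      by (auto simp: o_def intro: has_derivative_at_withinI)
    then show ?thesis unfolding partial_deriv_def by (rule vector_derivative_at)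
  qed
  then show ?thesis by (simp add: formal_deriv_def matrix_def)
qed

theorem theorem3p1:
  fixes L K :: real
  assumes "CARD('n::finite) \<ge> 2"
  shows "\<exists>C'. \<forall>\<phi> :: real^'n \<Rightarrow> real^'n.
    L-lipschitz_on (sphere 0 1) \<phi> \<longrightarrow>
    quasiregular K (ball 0 1) (poisson_integral \<phi>) \<longrightarrow>
    C'-lipschitz_on (ball 0 1) (poisson_integral \<phi>)"
proof -
  obtain T where T: "0 \<le> T"
    "\<And>(\<phi> :: real^'n \<Rightarrow> real^'n) L x D v. L-lipschitz_on (sphere 0 1) \<phi> \<Longrightarrow> x \<in> ball 0 1 \<Longrightarrow> x \<noteq> 0 \<Longrightarrow>
      (poisson_integral \<phi> has_derivative D) (at x) \<Longrightarrow> v \<bullet> x = 0 \<Longrightarrow> norm v = 1 \<Longrightarrow>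
      norm (D v) \<le> T * L"
    using norm_derivative_poisson_integral_orthogonal_le by blast
  \<comment> \<open>\<open>T\<close> comes from the dimension alone, so \<open>C\<close> is fixed by
    \<open>n\<close>, \<open>K\<close> and \<open>L\<close> before \<open>\<phi>\<close> is
    chosen.\<close>
  define C where "C = K * fact CARD('n) * (T * L)"
  show ?thesis
  proof (intro exI[of _ C] allI impI)
    fix \<phi> :: "real^'n \<Rightarrow> real^'n"
    let ?u = "poisson_integral \<phi>"
    assume \<phi>: "L-lipschitz_on (sphere 0 1) \<phi>" and qr: "quasiregular K (ball 0 1) ?u"
    have L0: "0 \<le> L" using \<phi> by (rule lipschitz_on_nonneg)
    have K: "1 \<le> K" using qr by (simp add: quasiregular_def)
    have C0: "0 \<le> C" using L0 K T by (simp add: C_def)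
    have cont: "continuous_on (sphere 0 1) \<phi>" using \<phi> by (rule lipschitz_on_continuous_on)
    define D where "D x h = (LINT \<xi>:sphere 0 1|sphere_measure. (poisson_grad x \<xi> \<bullet> h) *\<^sub>R \<phi> \<xi>)" for x h
    have der: "(?u has_derivative D x) (at x)" if "x \<in> ball 0 1" for x
      using has_derivative_poisson_integral[OF cont that] by (simp add: D_def[abs_def])
    have D_mat: "(*v) (formal_deriv ?u x) = D x" if "x \<in> ball 0 1" for x
      using formal_deriv_eq_matrix[OF der[OF that]] has_derivative_linear[OF der[OF that]]
      by (simp add: fun_eq_iff matrix_works)
    \<comment> \<open>For fixed \<open>h\<close> both sides involve only a continuous function of
      \<open>x\<close> and a constant, so an almost everywhere inequality suffices.\<close>
    have bound: "norm (D x h) \<le> C * norm h" if x: "x \<in> ball 0 1" for x h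
    proof (rule AE_le_imp_le_on_open[OF open_ball _ _ x])
      show "continuous_on (ball 0 1) (\<lambda>x. norm (D x h))"
        unfolding D_def using cont by (intro continuous_on_norm continuous_on_derivative_poisson_integral)
      have "AE x in lebesgue. x \<in> ball 0 1 \<longrightarrow>
          onorm ((*v) (formal_deriv ?u x)) ^ CARD('n) \<le> K * det (formal_deriv ?u x)"
        using qr by (simp add: quasiregular_def)
      \<comment> \<open>The origin has no radial direction, as \<open>sgn 0\<close> is not a unit
        vector; it is a null set and can be left out.\<close>
      moreover have "AE x in lebesgue. x \<noteq> (0 :: real^'n)"
        by (rule AE_completion) (rule AE_lborel_singleton)
      ultimately show "AE x in lebesgue. x \<in> ball 0 1 \<longrightarrow> norm (D x h) \<le> C * norm h"
      proof eventually_elim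
        case (elim x)
        show ?case
        proof
          assume x: "x \<in> ball 0 1"
          let ?A = "formal_deriv ?u x"
          have "onorm ((*v) ?A) \<le> K * fact CARD('n) * (T * L)"
          proof (rule onorm_le_of_quasiconformal[OF assms K])
            show "onorm ((*v) ?A) ^ CARD('n) \<le> K * det ?A" using elim x by blast
            show "norm (sgn x) = 1" using elim by (simp add: norm_sgn)
            fix v assume "v \<bullet> sgn x = 0" "norm v = 1"
            then have "norm (D x v) \<le> T * L"
              using elim by (intro T(2)[OF \<phi> x _ der[OF x]]) (auto simp: sgn_div_norm)
            then show "norm (?A *v v) \<le> T * L" by (simp add: D_mat[OF x])
          qed (use T L0 in simp)
          then have "onorm (D x) \<le> C" by (simp add: D_mat[OF x] C_def)
          then show "norm (D x h) \<le> C * norm h"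
            using onorm[OF has_derivative_bounded_linear[OF der[OF x]], of h]
            by (meson mult_right_mono norm_ge_zero order_trans)
        qed
      qed
    qed
    \<comment> \<open>The ball is convex, so the derivative bound integrates along segments to the
      Lipschitz bound.\<close>
    show "C-lipschitz_on (ball 0 1) ?u"
    proof (rule lipschitz_onI)
      fix x y :: "real^'n" assume "x \<in> ball 0 1" "y \<in> ball 0 1"
      then have "norm (?u x - ?u y) \<le> C * norm (x - y)"
        using bound by (intro differentiable_bound[where S = "ball 0 1" and f' = D])
          (auto intro: has_derivative_at_withinI[OF der] onorm_bound[OF C0])
      then show "dist (?u x) (?u y) \<le> C * dist x y" by (simp add: dist_norm)
    qed (rule C0)
  qed
qed

end
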